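(* For any $\delta\in\mathbb C$ the algebra $C_n(\delta)\subset B_n(\delta)$ is commutative for $n\leqslant5$ and non-commutative for $n\geqslant6$. More precisely, for $n\geqslant6$ and $f_{\max}=\lfloor n/2\rfloor$: (i) the quotient algebra $C_n(\delta)/\big(C_n(\delta)\cap J^{(f)}\big)$ is commutative for $f=1,2$ and non-commutative for $f=3,\dots,f_{\max}$; (ii) the subalgebra $C_n(\delta)\cap J^{(f)}$ is commutative for $f=f_{\max}$ and non-commutative for $f=0,\dots,f_{\max}-1$.
   Context: The Brauer algebra $B_n(\delta)$ has as basis the perfect matchings (diagrams) of $n$ upper and $n$ lower nodes; $b_1b_2$ is computed by placing $b_1$ below $b_2$, identifying the upper nodes of $b_1$ with the lower nodes of $b_2$, and replacing each closed loop by a factor $\delta$. A line joining two nodes of the same row is an arc; a diagram has the same number of arcs in each row and "has $f$ arcs" if there are $f$ arcs in either row. Diagrams with $0$ arcs span $\mathbb C\mathfrak S_n\subset B_n(\delta)$. $J^{(f)}$ is the two-sided ideal spanned by all diagrams with at least $f$ arcs ($J^{(0)}=B_n(\delta)$). $C_n(\delta)$ is the centraliser of $\mathbb C\mathfrak S_n$ in $B_n(\delta)$. *)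

theory Defs
  imports "HOL-Algebra.QuotRing" "HOL-Library.Disjoint_Sets" Complex_Main
begin

datatype node = Lower nat | Upper nat

type_synonym diagram = "node set set"

definition nodes :: "nat \<Rightarrow> node set" where
  "nodes n = Lower ` {1..n} \<union> Upper ` {1..n}"

definition diagrams :: "nat \<Rightarrow> diagram set" where
  "diagrams n = {b. partition_on (nodes n) b \<and> (\<forall>e\<in>b. card e = 2)}"

text \<open>A diagram has as many arcs in the lower row as in the upper row, see
  \<open>num_arcs_lower\<close> below.\<close>

definition num_arcs :: "diagram \<Rightarrow> nat" where
  "num_arcs b = card {e \<in> b. e \<subseteq> range Upper}"


text \<open>To multiply \<open>b1\<close> and \<open>b2\<close>, place \<open>b1\<close> below \<open>b2\<close>: the upper nodes of \<open>b1\<close> and the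
  lower nodes of \<open>b2\<close> become the middle row of a graph with three rows. Two copies of the same
  edge in the middle row (one from each diagram) are merged in \<open>stack\<close>; this changes neither
  the connected components nor, as loops are counted as components, their number.\<close>

datatype vertex = Bot nat | Mid nat | Top nat

fun place_below :: "node \<Rightarrow> vertex" where
  "place_below (Lower i) = Bot i"
| "place_below (Upper i) = Mid i"

fun place_above :: "node \<Rightarrow> vertex" where
  "place_above (Lower i) = Mid i"
| "place_above (Upper i) = Top i"

fun outer :: "node \<Rightarrow> vertex" where
  "outer (Lower i) = Bot i"
| "outer (Upper i) = Top i"

definition stack :: "diagram \<Rightarrow> diagram \<Rightarrow> vertex set set" where
  "stack b1 b2 = (\<lambda>e. place_below ` e) ` b1 \<union> (\<lambda>e. place_above ` e) ` b2"

definition linked :: "diagram \<Rightarrow> diagram \<Rightarrow> (vertex \<times> vertex) set" where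
  "linked b1 b2 = {(x, y). {x, y} \<in> stack b1 b2}\<^sup>*"

definition compose_diagrams :: "nat \<Rightarrow> diagram \<Rightarrow> diagram \<Rightarrow> diagram" where
  "compose_diagrams n b1 b2 =
     {{x, y} | x y. x \<in> nodes n \<and> y \<in> nodes n \<and> x \<noteq> y \<and> (outer x, outer y) \<in> linked b1 b2}"

text \<open>Every middle vertex lies on one edge of each diagram, so the components that stay in the
  middle row are exactly the closed loops.\<close>

definition num_loops :: "nat \<Rightarrow> diagram \<Rightarrow> diagram \<Rightarrow> nat" where
  "num_loops n b1 b2 = card {K \<in> Mid ` {1..n} // linked b1 b2. K \<subseteq> range Mid}"

definition id_diagram :: "nat \<Rightarrow> diagram" where
  "id_diagram n = (\<lambda>i. {Lower i, Upper i}) ` {1..n}"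


text \<open>A linear combination of diagrams is its coefficient function, so the span of a set \<open>S\<close> of
  diagrams in \<open>diagrams n\<close> (a finite set) consists of the functions vanishing outside \<open>S\<close>.\<close>

definition diagram_span :: "diagram set \<Rightarrow> (diagram \<Rightarrow> complex) set" where
  "diagram_span S = {a. \<forall>b. b \<notin> S \<longrightarrow> a b = 0}"

text \<open>The locale \<open>algebra\<close> of HOL-Algebra only covers commutative algebras, so the Brauer algebra
  is given by its ring structure. The scalars act pointwise; whether products commute does not
  involve them.\<close>

definition brauer :: "nat \<Rightarrow> complex \<Rightarrow> (diagram \<Rightarrow> complex) ring" where
  "brauer n \<delta> =
     \<lparr> carrier = diagram_span (diagrams n),
       mult = (\<lambda>a a' b. \<Sum>(b1, b2) \<in> {(b1, b2). b1 \<in> diagrams n \<and> b2 \<in> diagrams n \<and>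
                 compose_diagrams n b1 b2 = b}. a b1 * a' b2 * \<delta> ^ num_loops n b1 b2),
       one = (\<lambda>b. if b = id_diagram n then 1 else 0),
       zero = (\<lambda>b. 0),
       add = (\<lambda>a a' b. a b + a' b) \<rparr>"

definition symmetric_group_algebra :: "nat \<Rightarrow> (diagram \<Rightarrow> complex) set" where
  "symmetric_group_algebra n = diagram_span {b \<in> diagrams n. num_arcs b = 0}"

definition arc_ideal :: "nat \<Rightarrow> nat \<Rightarrow> (diagram \<Rightarrow> complex) set" where
  "arc_ideal n f = diagram_span {b \<in> diagrams n. num_arcs b \<ge> f}"

definition centraliser_algebra :: "nat \<Rightarrow> complex \<Rightarrow> (diagram \<Rightarrow> complex) ring" where
  "centraliser_algebra n \<delta> = (brauer n \<delta>)
     \<lparr> carrier := {a \<in> carrier (brauer n \<delta>). \<forall>s \<in> symmetric_group_algebra n.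
                     a \<otimes>\<^bsub>brauer n \<delta>\<^esub> s = s \<otimes>\<^bsub>brauer n \<delta>\<^esub> a} \<rparr>"

definition centraliser_ideal :: "nat \<Rightarrow> complex \<Rightarrow> nat \<Rightarrow> (diagram \<Rightarrow> complex) set" where
  "centraliser_ideal n \<delta> f = carrier (centraliser_algebra n \<delta>) \<inter> arc_ideal n f"

text \<open>\<open>cring\<close> is not used because the algebras \<open>C \<inter> J\<close> need not have a unit.\<close>

definition commutative :: "('a, 'm) monoid_scheme \<Rightarrow> bool" where
  "commutative A \<longleftrightarrow> (\<forall>x \<in> carrier A. \<forall>y \<in> carrier A. x \<otimes>\<^bsub>A\<^esub> y = y \<otimes>\<^bsub>A\<^esub> x)"


lemma finite_diagrams: "finite (diagrams n)"
proof -
  have "diagrams n \<subseteq> Pow (Pow (nodes n))"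
    unfolding diagrams_def partition_on_def by auto
  moreover have "finite (nodes n)" by (simp add: nodes_def)
  ultimately show ?thesis by (meson finite_Pow_iff finite_subset)
qed

lemma num_arcs_lower:
  assumes "b \<in> diagrams n"
  shows "card {e \<in> b. e \<subseteq> range Lower} = num_arcs b"
proof -
  have part: "partition_on (nodes n) b" and two: "\<And>e. e \<in> b \<Longrightarrow> card e = 2"
    using assms by (auto simp: diagrams_def)
  have un: "\<Union>b = nodes n" using part by (simp add: partition_on_def)
  have disj: "\<And>d e. d \<in> b \<Longrightarrow> e \<in> b \<Longrightarrow> d \<noteq> e \<Longrightarrow> d \<inter> e = {}"
    using part by (auto simp: partition_on_def disjoint_def)
  have fn: "finite (nodes n)" by (simp add: nodes_def)
  have fb: "finite b" using un fn by (metis finite_UnionD)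
  let ?L = "{e \<in> b. e \<subseteq> range Lower}" and ?U = "{e \<in> b. e \<subseteq> range Upper}"
  define T where "T = b - ?L - ?U"
  have cases: "\<And>x. x \<in> range Lower \<or> x \<in> range Upper" by (metis node.exhaust rangeI)
  have dLU: "range Lower \<inter> range Upper = {}" by auto
  have row: "n = 2 * card {e \<in> b. e \<subseteq> R} + card T"
    if R: "R = range Lower \<and> R' = range Upper \<or> R = range Upper \<and> R' = range Lower"
      and card: "card (nodes n \<inter> R) = n" for R R'
  proof -
    have "nodes n \<inter> R = (\<Union>e\<in>b. e \<inter> R)" using un by auto
    then have "n = card (\<Union>e\<in>b. e \<inter> R)" using card by simp
    also have "\<dots> = (\<Sum>e\<in>b. card (e \<inter> R))"
      by (rule card_UN_disjoint) (use fb disj two in \<open>auto intro!: finite_Int intro: card_ge_0_finite\<close>)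
    also have "\<dots> = (\<Sum>e\<in>b. if e \<subseteq> R then 2 else if e \<subseteq> R' then 0 else 1)"
    proof (rule sum.cong[OF refl])
      fix e assume e: "e \<in> b"
      obtain x y where xy: "e = {x, y}" "x \<noteq> y" using two[OF e] by (meson card_2_iff)
      show "card (e \<inter> R) = (if e \<subseteq> R then 2 else if e \<subseteq> R' then 0 else 1)"
        using R xy dLU cases[of x] cases[of y] by (auto simp: Int_insert_left)
    qed
    also have "\<dots> = (\<Sum>e\<in>b. (if e \<subseteq> R then 2 else 0) + (if e \<in> T then 1 else 0))"
    proof (rule sum.cong[OF refl])
      fix e assume e: "e \<in> b"
      obtain x where "x \<in> e" using two[OF e] by fastforce
      then show "(if e \<subseteq> R then 2 else if e \<subseteq> R' then 0 else 1) =
          (if e \<subseteq> R then 2 else 0) + (if e \<in> T then 1 else (0::nat))"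
        using R e dLU by (auto simp: T_def)
    qed
    also have "\<dots> = 2 * card {e \<in> b. e \<subseteq> R} + card {e \<in> b. e \<in> T}"
      using fb by (simp add: sum.distrib sum.If_cases Int_def)
    also have "{e \<in> b. e \<in> T} = T" by (auto simp: T_def)
    finally show ?thesis .
  qed
  have "nodes n \<inter> range Lower = Lower ` {1..n}" "nodes n \<inter> range Upper = Upper ` {1..n}"
    by (auto simp: nodes_def)
  then have "card (nodes n \<inter> range Lower) = n" "card (nodes n \<inter> range Upper) = n"
    by (simp_all add: card_image inj_on_def)
  then have "n = 2 * card ?L + card T" "n = 2 * card ?U + card T"
    by (intro row; blast)+
  then show ?thesis unfolding num_arcs_def by linarith
qed

end

theory Submission
  imports Defs "HOL-Combinatorics.Permutations"
begin

text \<open>The elements of the centraliser are the functions on diagrams that are invariant under permuting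
  both rows simultaneously, and turning a diagram upside down is an anti-automorphism. Hence, by
  Gelfand's trick, commutativity holds wherever the diagrams involved are conjugate to their flips.
  Identifying the two nodes of each column makes a diagram a union of cycles, and it is conjugate to
  its flip if each cycle has a reflection that exchanges the rows. This is the case if there is
  at most one arc in each row, or at most one through line.

  Conversely, let \<open>2 \<le> f\<close> and \<open>2 f + 2 \<le> n\<close>. Among the diagrams with \<open>f\<close> arcs and vertical through
  lines, let \<open>x\<close> be the sum of those equal to their flips and \<open>y\<close> the sum of those whose two rows
  disagree in at most four points. There is a diagram with \<open>f\<close> arcs that does not occur in \<open>x y\<close> but
  does occur in \<open>y x\<close>, and only from pairs of diagrams without closed loops, so that its
  coefficient in \<open>y x\<close> is a positive integer whatever \<open>\<delta>\<close> is. The values \<open>f = 2\<close> and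
  \<open>f = n div 2 - 1\<close> settle the quotients and the ideals, respectively.\<close>

section \<open>Diagrams as involutions\<close>

text \<open>Along a cycle, passing an arc changes the row and passing a through line keeps it. So a
  reflection preserves the rows if it respects the positions of the arcs: with one arc in each row
  it can exchange these two, with a single through line it can be centred there. For
  \<open>n \<le> 5\<close> every diagram falls under one of these cases. For the converse, the
  obstacle is \<delta>: a coefficient of a product is a polynomial in \<delta>, which may vanish at
  special values. The bound four removes all loops. Whenever an element of the set behind
  \<open>y\<close>, followed by a symmetric one, gives the target diagram, four of its columns are
  forced to be asymmetric. The bound makes all the others symmetric, and then the middle row has to
  follow the path of the target, leaving no room for a loop. The condition
  \<open>2 f + 2 \<le> n\<close> provides two columns beyond the \<open>2 f\<close> upper arc nodes;
  they carry a lower arc of the target below two upper ends of through lines. Both \<open>x\<close>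
  and \<open>y\<close> are invariant under the flip, so \<open>y x\<close> is the flip of
  \<open>x y\<close>; they differ because the product itself is not invariant under the
  flip.\<close>

definition partner :: "diagram \<Rightarrow> node \<Rightarrow> node" where
  "partner b x = (THE y. {x, y} \<in> b)"

lemma finite_nodes [simp]: "finite (nodes n)"
  by (simp add: nodes_def)

lemma in_nodes_iff [simp]:
  "Lower i \<in> nodes n \<longleftrightarrow> 1 \<le> i \<and> i \<le> n" "Upper i \<in> nodes n \<longleftrightarrow> 1 \<le> i \<and> i \<le> n"
  by (auto simp: nodes_def)

lemma partner_eqI:
  assumes "b \<in> diagrams n" "{x, y} \<in> b"
  shows "partner b x = y"
  unfolding partner_def
proof (rule the_equality)
  fix z assume z: "{x, z} \<in> b"
  have "card {x, y} = 2" "card {x, z} = 2" using assms z by (auto simp: diagrams_def)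
  then have "x \<noteq> y" "x \<noteq> z" by auto
  moreover have "{x, y} = {x, z}"
    using assms z by (auto simp: diagrams_def dest!: partition_onD2 disjointD[of b "{x, y}" "{x, z}"])
  ultimately show "z = y" by (auto simp: doubleton_eq_iff)
qed (use assms in simp)

lemma partner_edge:
  assumes "b \<in> diagrams n" "x \<in> nodes n"
  shows "{x, partner b x} \<in> b"
proof -
  obtain e where e: "e \<in> b" "x \<in> e"
    using assms by (auto simp: diagrams_def partition_on_def)
  then have "card e = 2" using assms by (auto simp: diagrams_def)
  then obtain y where "e = {x, y}" using e(2) by (auto simp: card_2_iff)
  then show ?thesis using partner_eqI[OF assms(1)] e(1) by metis
qed

lemma edge_in_nodes:
  assumes "b \<in> diagrams n" "{x, y} \<in> b"
  shows "x \<in> nodes n" "y \<in> nodes n" "x \<noteq> y"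
proof -
  have "card {x, y} = 2" using assms by (auto simp: diagrams_def)
  then show "x \<noteq> y" by auto
  show "x \<in> nodes n" "y \<in> nodes n"
    using assms by (auto simp: diagrams_def dest!: partition_onD1)
qed

lemma edge_iff:
  assumes "b \<in> diagrams n"
  shows "{x, y} \<in> b \<longleftrightarrow> x \<in> nodes n \<and> partner b x = y"
  using assms partner_edge partner_eqI edge_in_nodes by metis

lemma partner_in_nodes: "b \<in> diagrams n \<Longrightarrow> x \<in> nodes n \<Longrightarrow> partner b x \<in> nodes n"
  and partner_neq: "b \<in> diagrams n \<Longrightarrow> x \<in> nodes n \<Longrightarrow> partner b x \<noteq> x"
  and partner_partner: "b \<in> diagrams n \<Longrightarrow> x \<in> nodes n \<Longrightarrow> partner b (partner b x) = x"
  using partner_edge edge_in_nodes partner_eqI by (metis insert_commute)+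

lemma diagram_eq_edges:
  assumes "b \<in> diagrams n"
  shows "b = {{x, partner b x} | x. x \<in> nodes n}"
proof
  show "b \<subseteq> {{x, partner b x} | x. x \<in> nodes n}"
  proof
    fix e assume e: "e \<in> b"
    then have "card e = 2" using assms by (auto simp: diagrams_def)
    then obtain x y where "e = {x, y}" by (auto simp: card_2_iff)
    then show "e \<in> {{x, partner b x} | x. x \<in> nodes n}"
      using e edge_iff[OF assms] by auto
  qed
qed (use partner_edge[OF assms] in auto)

text \<open>Both are perfect matchings, so one inclusion between the sets of edges is already an
  equality.\<close>

lemma diagram_eqI:
  assumes "b \<in> diagrams n" "c \<in> diagrams n" "\<And>x. x \<in> nodes n \<Longrightarrow> {x, partner b x} \<in> c"
  shows "b = c"
proof -
  have "partner b x = partner c x" if "x \<in> nodes n" for x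
    using assms that partner_eqI by metis
  then have "{{x, partner b x} | x. x \<in> nodes n} = {{x, partner c x} | x. x \<in> nodes n}"
    by metis
  then show ?thesis
    using diagram_eq_edges[OF assms(1)] diagram_eq_edges[OF assms(2)] by simp
qed

lemma involution_diagram:
  assumes "\<And>x. x \<in> nodes n \<Longrightarrow> g x \<in> nodes n" "\<And>x. x \<in> nodes n \<Longrightarrow> g x \<noteq> x"
    "\<And>x. x \<in> nodes n \<Longrightarrow> g (g x) = x"
  shows "{{x, g x} | x. x \<in> nodes n} \<in> diagrams n"
  unfolding diagrams_def partition_on_def
proof (intro CollectI conjI ballI)
  show "\<Union> {{x, g x} | x. x \<in> nodes n} = nodes n" using assms(1) by auto
  show "disjoint {{x, g x} | x. x \<in> nodes n}"
    unfolding disjoint_def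
  proof (intro ballI impI)
    fix u v assume "u \<in> {{x, g x} | x. x \<in> nodes n}" "v \<in> {{x, g x} | x. x \<in> nodes n}" "u \<noteq> v"
    then obtain x y where xy: "x \<in> nodes n" "y \<in> nodes n" "u = {x, g x}" "v = {y, g y}" by auto
    then have "x \<noteq> y" using \<open>u \<noteq> v\<close> by auto
    moreover have "x \<noteq> g y" "g x \<noteq> y" using xy assms(3) \<open>u \<noteq> v\<close> by (auto simp: insert_commute)
    moreover have "g x \<noteq> g y" using xy assms(3) \<open>x \<noteq> y\<close> by metis
    ultimately show "u \<inter> v = {}" using xy by auto
  qed
  show "card e = 2" if "e \<in> {{x, g x} | x. x \<in> nodes n}" for e
    using that assms(2) by (force simp: card_2_iff)
qed auto

text \<open>A separate name, because \<open>inv\<close> is the notation for inverses in a monoid in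
  HOL-Algebra.\<close>

abbreviation inv_fun :: "('a \<Rightarrow> 'b) \<Rightarrow> 'b \<Rightarrow> 'a" where
  "inv_fun \<equiv> inv_into UNIV"

section \<open>Relabelling: the flip and permutations of the rows\<close>

definition relabel :: "(node \<Rightarrow> node) \<Rightarrow> diagram \<Rightarrow> diagram" where
  "relabel g b = (\<lambda>e. g ` e) ` b"

lemma relabel_edge: "{x, y} \<in> b \<Longrightarrow> {g x, g y} \<in> relabel g b"
  using imageI[of "{x, y}" b "\<lambda>e. g ` e"] by (simp add: relabel_def)

lemma relabel_relabel: "relabel g (relabel h b) = relabel (g \<circ> h) b"
  by (simp add: relabel_def image_comp comp_def)

lemma relabel_ident [simp]: "relabel id b = b" "relabel (\<lambda>x. x) b = b"
  by (simp_all add: relabel_def)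

lemma relabel_in_diagrams:
  assumes "bij_betw g (nodes n) (nodes n)" "b \<in> diagrams n"
  shows "relabel g b \<in> diagrams n"
proof -
  have inj: "inj_on g (nodes n)" and im: "g ` nodes n = nodes n"
    using assms(1) by (auto simp: bij_betw_def)
  have p: "partition_on (nodes n) b" and two: "\<And>e. e \<in> b \<Longrightarrow> card e = 2"
    using assms(2) by (auto simp: diagrams_def)
  have sub: "e \<subseteq> nodes n" if "e \<in> b" for e using p that by (auto simp: partition_on_def)
  have "partition_on (nodes n) (relabel g b)"
    unfolding partition_on_def
  proof (intro conjI)
    show "\<Union> (relabel g b) = nodes n"
      using partition_onD1[OF p] im unfolding relabel_def by (metis image_Union)
    show "{} \<notin> relabel g b" using p by (auto simp: relabel_def partition_on_def)
    show "disjoint (relabel g b)"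
      unfolding relabel_def disjoint_def
    proof (intro ballI impI)
      fix u v assume "u \<in> (\<lambda>e. g ` e) ` b" "v \<in> (\<lambda>e. g ` e) ` b" "u \<noteq> v"
      then obtain d e where de: "d \<in> b" "e \<in> b" "d \<noteq> e" "u = g ` d" "v = g ` e" by auto
      then have "d \<inter> e = {}" using p by (auto simp: partition_on_def disjoint_def)
      then show "u \<inter> v = {}"
        using de sub inj_on_image_Int[OF inj, of d e] by (metis image_empty)
    qed
  qed
  moreover have "card e = 2" if "e \<in> relabel g b" for e
    using that two sub inj_on_subset[OF inj] by (auto simp: relabel_def card_image)
  ultimately show ?thesis by (simp add: diagrams_def)
qed

lemma partner_relabel:
  assumes "bij_betw g (nodes n) (nodes n)" "b \<in> diagrams n" "x \<in> nodes n"
  shows "partner (relabel g b) (g x) = g (partner b x)"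
  using partner_eqI[OF relabel_in_diagrams[OF assms(1,2)] relabel_edge[OF partner_edge]] assms by blast

fun swap_row :: "node \<Rightarrow> node" where
  "swap_row (Lower i) = Upper i"
| "swap_row (Upper i) = Lower i"

text \<open>Independent permutations of the rows cover both the one-sided actions of the symmetric
  group (\<open>id\<close> in one row) and conjugation (\<open>p = q\<close>).\<close>

fun node_map :: "(nat \<Rightarrow> nat) \<Rightarrow> (nat \<Rightarrow> nat) \<Rightarrow> node \<Rightarrow> node" where
  "node_map p q (Lower i) = Lower (p i)"
| "node_map p q (Upper i) = Upper (q i)"

lemma swap_row_swap_row [simp]: "swap_row (swap_row x) = x"
  by (cases x) auto

lemma swap_row_in_nodes [simp]: "swap_row x \<in> nodes n \<longleftrightarrow> x \<in> nodes n"
  by (cases x) auto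

lemma bij_swap_row: "bij_betw swap_row (nodes n) (nodes n)"
  by (rule bij_betw_byWitness[where f' = swap_row]) auto

lemma node_map_comp: "node_map p q \<circ> node_map p' q' = node_map (p \<circ> p') (q \<circ> q')"
proof
  fix x show "(node_map p q \<circ> node_map p' q') x = node_map (p \<circ> p') (q \<circ> q') x"
    by (cases x) auto
qed

lemma node_map_id [simp]: "node_map id id = id" "node_map (\<lambda>x. x) (\<lambda>x. x) = id"
proof -
  show "node_map id id = id"
  proof
    fix x show "node_map id id x = id x" by (cases x) auto
  qed
  then show "node_map (\<lambda>x. x) (\<lambda>x. x) = id" by (simp add: id_def)
qed

lemma node_map_in_nodes:
  assumes "p permutes {1..n}" "q permutes {1..n}" "x \<in> nodes n"
  shows "node_map p q x \<in> nodes n"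
  using assms permutes_in_image[OF assms(1)] permutes_in_image[OF assms(2)]
  by (cases x) auto

lemma node_map_inverse:
  assumes "p permutes {1..n}" "q permutes {1..n}"
  shows "node_map p q \<circ> node_map (inv_fun p) (inv_fun q) = id" "node_map (inv_fun p) (inv_fun q) \<circ> node_map p q = id"
  using assms by (simp_all add: node_map_comp permutes_inv_o)

lemma bij_node_map:
  assumes "p permutes {1..n}" "q permutes {1..n}"
  shows "bij_betw (node_map p q) (nodes n) (nodes n)"
proof (rule bij_betw_byWitness[where f' = "node_map (inv_fun p) (inv_fun q)"])
  show "node_map p q ` nodes n \<subseteq> nodes n"
    using node_map_in_nodes[OF assms] by blast
  show "node_map (inv_fun p) (inv_fun q) ` nodes n \<subseteq> nodes n"
    using node_map_in_nodes[OF assms[THEN permutes_inv]] by blast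
qed (use node_map_inverse[OF assms] in \<open>auto simp: pointfree_idE\<close>)

lemma relabel_swap_row_swap_row [simp]: "relabel swap_row (relabel swap_row b) = b"
  by (simp add: relabel_relabel comp_def)

lemma swap_row_in_diagrams [simp]: "relabel swap_row b \<in> diagrams n \<longleftrightarrow> b \<in> diagrams n"
  using relabel_in_diagrams[OF bij_swap_row] relabel_swap_row_swap_row by metis

lemma relabel_node_map_inv:
  assumes "p permutes {1..n}" "q permutes {1..n}"
  shows "relabel (node_map p q) (relabel (node_map (inv_fun p) (inv_fun q)) b) = b"
    and "relabel (node_map (inv_fun p) (inv_fun q)) (relabel (node_map p q) b) = b"
  using node_map_inverse[OF assms] by (simp_all add: relabel_relabel)

lemma node_map_in_diagrams:
  assumes "p permutes {1..n}" "q permutes {1..n}" "b \<in> diagrams n"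
  shows "relabel (node_map p q) b \<in> diagrams n"
  using relabel_in_diagrams[OF bij_node_map] assms by blast

lemma id_diagram_in_diagrams: "id_diagram n \<in> diagrams n"
proof -
  have "{{x, swap_row x} | x. x \<in> nodes n} = id_diagram n" (is "?A = _")
  proof
    show "?A \<subseteq> id_diagram n"
    proof
      fix e assume "e \<in> ?A"
      then obtain x where "e = {x, swap_row x}" "x \<in> nodes n" by auto
      then show "e \<in> id_diagram n" by (cases x) (auto simp: id_diagram_def)
    qed
    show "id_diagram n \<subseteq> ?A" by (force simp: id_diagram_def)
  qed
  moreover have "?A \<in> diagrams n"
  proof (rule involution_diagram)
    show "swap_row x \<noteq> x" for x by (cases x) auto
  qed auto
  ultimately show ?thesis by simp
qed

text \<open>\<open>num_arcs\<close> counts upper arcs, which the flip turns into lower ones, so this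
  rests on the equality of the two counts.\<close>

lemma num_arcs_swap_row:
  assumes "b \<in> diagrams n"
  shows "num_arcs (relabel swap_row b) = num_arcs b"
proof -
  let ?S = "\<lambda>e. swap_row ` e"
  have "{e \<in> relabel swap_row b. e \<subseteq> range Upper} = ?S ` {e \<in> b. e \<subseteq> range Lower}"
  proof -
    have "?S e \<subseteq> range Upper \<longleftrightarrow> e \<subseteq> range Lower" for e
    proof -
      have "swap_row x \<in> range Upper \<longleftrightarrow> x \<in> range Lower" for x by (cases x) auto
      then show ?thesis unfolding image_subset_iff by blast
    qed
    then show ?thesis by (auto simp: relabel_def)
  qed
  moreover have "inj_on ?S X" for X
    by (rule inj_on_inverseI[where g = ?S]) (simp add: image_comp comp_def)
  ultimately have "num_arcs (relabel swap_row b) = card {e \<in> b. e \<subseteq> range Lower}"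
    by (simp add: num_arcs_def card_image)
  then show ?thesis using num_arcs_lower[OF assms] by simp
qed

lemma num_arcs_node_map: "num_arcs (relabel (node_map p q) b) = num_arcs b"
  if "p permutes {1..n}" "q permutes {1..n}"
proof -
  let ?S = "\<lambda>e. node_map p q ` e"
  have "?S e \<subseteq> range Upper \<longleftrightarrow> e \<subseteq> range Upper" for e
  proof -
    have "node_map p q x \<in> range Upper \<longleftrightarrow> x \<in> range Upper" for x by (cases x) auto
    then show ?thesis unfolding image_subset_iff by blast
  qed
  then have "{e \<in> relabel (node_map p q) b. e \<subseteq> range Upper} = ?S ` {e \<in> b. e \<subseteq> range Upper}"
    by (auto simp: relabel_def)
  moreover have "inj_on ?S X" for X
    by (rule inj_on_inverseI[where g = "\<lambda>e. node_map (inv_fun p) (inv_fun q) ` e"])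
      (use node_map_inverse[OF that] in \<open>simp add: image_comp\<close>)
  ultimately show ?thesis by (simp add: num_arcs_def card_image)
qed

section \<open>Columns covered by the arcs of a row\<close>

definition arc_nodes :: "(nat \<Rightarrow> node) \<Rightarrow> nat \<Rightarrow> diagram \<Rightarrow> nat set" where
  "arc_nodes R n b = {i \<in> {1..n}. partner b (R i) \<in> range R}"

lemma card_arc_nodes_aux:
  assumes b: "b \<in> diagrams n" and R: "inj R" "range R \<inter> nodes n = R ` {1..n}"
  shows "card (arc_nodes R n b) = 2 * card {e \<in> b. e \<subseteq> range R}"
proof -
  let ?A = "{e \<in> b. e \<subseteq> range R}"
  have "R ` arc_nodes R n b = \<Union> ?A"
  proof
    show "R ` arc_nodes R n b \<subseteq> \<Union> ?A"
    proof
      fix x assume "x \<in> R ` arc_nodes R n b"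
      then obtain i where i: "x = R i" "i \<in> {1..n}" "partner b x \<in> range R"
        by (auto simp: arc_nodes_def)
      then have "x \<in> nodes n" using R(2) by auto
      then show "x \<in> \<Union> ?A" using partner_edge[OF b] i by auto
    qed
    show "\<Union> ?A \<subseteq> R ` arc_nodes R n b"
    proof
      fix x assume "x \<in> \<Union> ?A"
      then obtain e where e: "e \<in> b" "e \<subseteq> range R" "x \<in> e" by auto
      then obtain y where y: "y \<in> nodes n" "e = {y, partner b y}"
        using diagram_eq_edges[OF b] by blast
      then have "x \<in> nodes n" "partner b x \<in> e"
        using e(3) partner_in_nodes[OF b] partner_partner[OF b] by auto
      then have "x \<in> R ` {1..n}" "partner b x \<in> range R" using e R(2) by auto
      then show "x \<in> R ` arc_nodes R n b" by (auto simp: arc_nodes_def)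
    qed
  qed
  then have "card (arc_nodes R n b) = card (\<Union> ?A)"
    using R(1) by (metis card_image inj_on_subset subset_UNIV)
  also have "\<dots> = (\<Sum>e\<in>?A. card e)"
    by (rule card_Union_disjoint)
      (use b in \<open>auto simp: diagrams_def partition_on_def disjoint_def pairwise_def disjnt_def intro: card_ge_0_finite\<close>)
  also have "\<dots> = (\<Sum>e\<in>?A. 2)"
    using b by (intro sum.cong) (auto simp: diagrams_def)
  finally show ?thesis by simp
qed

lemma range_row_Int_nodes:
  "range Lower \<inter> nodes n = Lower ` {1..n}" "range Upper \<inter> nodes n = Upper ` {1..n}"
  by (auto simp: nodes_def)

lemma card_arc_nodes:
  assumes "b \<in> diagrams n"
  shows "card (arc_nodes Upper n b) = 2 * num_arcs b" "card (arc_nodes Lower n b) = 2 * num_arcs b"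
  using card_arc_nodes_aux[OF assms, of Upper] card_arc_nodes_aux[OF assms, of Lower]
    num_arcs_lower[OF assms] range_row_Int_nodes
  by (simp_all add: inj_on_def num_arcs_def)

lemma num_arcs_le: "b \<in> diagrams n \<Longrightarrow> num_arcs b \<le> n div 2"
proof -
  assume b: "b \<in> diagrams n"
  have "card (arc_nodes Upper n b) \<le> card {1..n}"
    by (intro card_mono) (auto simp: arc_nodes_def)
  then show ?thesis using card_arc_nodes(1)[OF b] by simp
qed

lemma finite_arc_nodes [simp]: "finite (arc_nodes R n b)"
  by (simp add: arc_nodes_def)

section \<open>Composition of diagrams\<close>

lemma even_card_involution:
  assumes "finite K" and inv: "\<And>v. v \<in> K \<Longrightarrow> g v \<in> K \<and> g (g v) = v"
  shows "even (card K) \<longleftrightarrow> even (card {v \<in> K. g v = v})"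
proof -
  \<comment> \<open>\<open>?P\<close> is the set of pairs into which the points moved by
    \<open>g\<close> fall.\<close>
  let ?F = "{v \<in> K. g v = v}" and ?P = "(\<lambda>v. {v, g v}) ` {v \<in> K. g v \<noteq> v}"
  have un: "\<Union> ?P = {v \<in> K. g v \<noteq> v}" using inv by force
  have "2 dvd card (\<Union> ?P)"
  proof (rule dvd_partition)
    show "finite (\<Union> ?P)" using assms(1) un by simp
    show "\<forall>c\<in>?P. 2 dvd card c" by auto
    show "\<forall>c1\<in>?P. \<forall>c2\<in>?P. c1 \<noteq> c2 \<longrightarrow> c1 \<inter> c2 = {}"
    proof (intro ballI impI)
      fix c1 c2 assume "c1 \<in> ?P" "c2 \<in> ?P" "c1 \<noteq> c2"
      then obtain u v where uv: "u \<in> K" "v \<in> K" "c1 = {u, g u}" "c2 = {v, g v}" by auto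
      then have "u \<noteq> v" using \<open>c1 \<noteq> c2\<close> by auto
      moreover have "u \<noteq> g v" "g u \<noteq> v"
        using uv \<open>c1 \<noteq> c2\<close> inv[of u] inv[of v] by (metis insert_commute)+
      moreover have "g u \<noteq> g v" using uv inv \<open>u \<noteq> v\<close> by metis
      ultimately show "c1 \<inter> c2 = {}" using uv by auto
    qed
  qed
  moreover have "card K = card ?F + card {v \<in> K. g v \<noteq> v}"
    using assms(1) by (subst card_Un_disjoint[symmetric]) (auto intro: arg_cong[where f = card])
  ultimately show ?thesis unfolding un by simp
qed

text \<open>The orbit of a fixed point under two involutions is a path, traversed by applying the
  involutions alternately; the second end of the path exists for reasons of parity.\<close>

lemma involutions_orbit_fixed:
  assumes inv: "\<And>v. g (g v) = v" "\<And>v. h (h v) = v"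
    and x: "g x = x"
    and K: "K = {(u, v). v = g u \<or> v = h u}\<^sup>* `` {x}" "finite K"
    and disj: "\<And>v. v \<in> K \<Longrightarrow> \<not> (g v = v \<and> h v = v)"
  shows "\<exists>!y. y \<in> K \<and> y \<noteq> x \<and> (g y = y \<or> h y = y)"
proof -
  let ?F = "{v \<in> K. g v = v \<or> h v = v}"
  \<comment> \<open>As \<open>g\<close> fixes \<open>x\<close>, the path can leave \<open>x\<close>
    only by \<open>h\<close>; hence \<open>h\<close> at the even steps.\<close>
  define t where "t k = (if even k then h else g)" for k :: nat
  define w where "w = rec_nat x (\<lambda>k v. t k v)"
  have w: "w 0 = x" "w (Suc k) = t k (w k)" for k by (simp_all add: w_def)
  have tt: "t k (t k v) = v" for k v using inv by (simp add: t_def)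
  \<comment> \<open>The path is followed only while it moves: no step before \<open>j\<close> is
    stuck. Beyond its end, \<open>w\<close> would run backwards.\<close>
  define valid where "valid j \<longleftrightarrow> (\<forall>i<j. t i (w i) \<noteq> w i)" for j
  define S where "S = {w j | j. valid j}"
  have prev: "t j (w (Suc j)) = w j" for j by (simp add: w tt)
  \<comment> \<open>At \<open>w j\<close>, the involution of the parity of \<open>j\<close> leads
    forward or stops; the other one leads back to \<open>w (j - 1)\<close>, or fixes
    \<open>x\<close> if \<open>j = 0\<close>.\<close>
  have closed: "t k v \<in> S" if v: "v \<in> S" for k v
  proof -
    obtain j where j: "v = w j" "valid j" using v by (auto simp: S_def)
    show ?thesis
    proof (cases "even k = even j")
      case True
      then have t: "t k v = w (Suc j)" by (simp add: t_def w j)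
      show ?thesis
      proof (cases "t j (w j) = w j")
        case True
        then show ?thesis using v t j w by simp
      next
        case False
        then have "valid (Suc j)" using j by (auto simp: valid_def less_Suc_eq)
        then show ?thesis using t by (auto simp: S_def)
      qed
    next
      case False
      show ?thesis
      proof (cases j)
        case 0
        then show ?thesis using False x v j by (simp add: t_def w)
      next
        case (Suc i)
        then have "t k v = w i" using prev[of i] False j by (auto simp: t_def split: if_splits)
        moreover have "valid i" using j Suc by (auto simp: valid_def)
        ultimately show ?thesis by (auto simp: S_def)
      qed
    qed
  qed
  have "(x, v) \<in> {(u, v). v = g u \<or> v = h u}\<^sup>* \<Longrightarrow> v \<in> S" for v
  proof (induction rule: rtrancl_induct)
    case base
    show ?case by (auto simp: S_def valid_def w intro!: exI[of _ 0])
  next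
    case (step u v)
    then show ?case using closed[of u 0] closed[of u 1] by (auto simp: t_def)
  qed
  then have KS: "K \<subseteq> S" by (auto simp: K)
  \<comment> \<open>An end other than \<open>x\<close> is moved by the involution through which it
    was reached, so it is fixed by the next one. Its index is thus the first at which the path is
    stuck, which makes the end unique.\<close>
  have end_of_path: "\<exists>j. v = w j \<and> valid j \<and> t j (w j) = w j" if v: "v \<in> ?F" "v \<noteq> x" for v
  proof -
    have "v \<in> S" using v KS by blast
    then obtain j where j: "v = w j" "valid j" by (auto simp: S_def)
    then obtain i where i: "j = Suc i" using v w by (cases j) auto
    have "t i (w j) \<noteq> w j" using j(2) prev[of i] i w tt by (metis lessI valid_def)
    moreover have "g (w j) = w j \<or> h (w j) = w j" using v(1) j(1) by blast
    ultimately have "t j (w j) = w j" unfolding t_def i by (cases "even i") auto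
    then show ?thesis using j by blast
  qed
  have unique: "u = v" if uv: "u \<in> ?F" "v \<in> ?F" "u \<noteq> x" "v \<noteq> x" for u v
  proof -
    obtain i where i: "u = w i" "valid i" "t i (w i) = w i"
      using end_of_path[OF uv(1,3)] by blast
    obtain j where j: "v = w j" "valid j" "t j (w j) = w j"
      using end_of_path[OF uv(2,4)] by blast
    have "\<not> i < j" "\<not> j < i" using i j unfolding valid_def by blast+
    then have "i = j" by simp
    then show ?thesis using i j by simp
  qed
  have "g v \<in> K" "h v \<in> K" if "v \<in> K" for v
    using that unfolding K by (auto intro: rtrancl_into_rtrancl)
  \<comment> \<open>Both counts have the parity of \<open>card K\<close>. The two sets are disjoint,
    so the number of ends is even; as \<open>x\<close> is one of them, there is another.\<close>
  then have "even (card {v \<in> K. g v = v}) = even (card {v \<in> K. h v = v})"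
    using even_card_involution[OF K(2), of g] even_card_involution[OF K(2), of h] inv by simp
  moreover have "card ?F = card {v \<in> K. g v = v} + card {v \<in> K. h v = v}"
    using K(2) disj by (subst card_Un_disjoint[symmetric]) (auto intro: arg_cong[where f = card])
  ultimately have "even (card ?F)" by simp
  moreover have "x \<in> ?F" using x by (auto simp: K)
  ultimately have "?F \<noteq> {x}" by auto
  then obtain y where "y \<in> ?F" "y \<noteq> x" using \<open>x \<in> ?F\<close> by blast
  then show ?thesis using unique[of _ y] by (intro ex1I[of _ y]) blast+
qed

section \<open>The stacked graph and its components\<close>

lemma doubleton_eq_imageE:
  assumes "{u, v} = f ` e" "card e = 2" "inj f"
  obtains x y where "e = {x, y}" "u = f x" "v = f y"
proof -
  obtain x y where xy: "e = {x, y}" using assms(2) by (auto simp: card_2_iff)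
  then have "u = f x \<and> v = f y \<or> u = f y \<and> v = f x"
    using assms(1) by (auto simp: doubleton_eq_iff)
  then show ?thesis using that[of x y] that[of y x] xy by (auto simp: insert_commute)
qed

lemma inj_place: "inj place_below" "inj place_above" "inj outer"
proof -
  show "inj place_below"
  proof (rule injI)
    fix x y assume "place_below x = place_below y"
    then show "x = y" by (cases x; cases y) auto
  qed
  show "inj place_above"
  proof (rule injI)
    fix x y assume "place_above x = place_above y"
    then show "x = y" by (cases x; cases y) auto
  qed
  show "inj outer"
  proof (rule injI)
    fix x y assume "outer x = outer y"
    then show "x = y" by (cases x; cases y) auto
  qed
qed

lemma stack_below: "{x, y} \<in> b1 \<Longrightarrow> {place_below x, place_below y} \<in> stack b1 b2"
  using imageI[of "{x, y}" b1 "\<lambda>e. place_below ` e"] by (simp add: stack_def)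

lemma stack_above: "{x, y} \<in> b2 \<Longrightarrow> {place_above x, place_above y} \<in> stack b1 b2"
  using imageI[of "{x, y}" b2 "\<lambda>e. place_above ` e"] by (simp add: stack_def)

lemma stack_edge_iff:
  assumes "b1 \<in> diagrams n" "b2 \<in> diagrams n"
  shows "{u, v} \<in> stack b1 b2 \<longleftrightarrow>
    (\<exists>x y. {x, y} \<in> b1 \<and> u = place_below x \<and> v = place_below y) \<or>
    (\<exists>x y. {x, y} \<in> b2 \<and> u = place_above x \<and> v = place_above y)" (is "?l \<longleftrightarrow> ?r")
proof
  assume ?l
  then consider e where "e \<in> b1" "{u, v} = place_below ` e" | e where "e \<in> b2" "{u, v} = place_above ` e"
    by (auto simp: stack_def)
  then show ?r
  proof cases
    case 1
    then have "card e = 2" using assms by (auto simp: diagrams_def)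
    from doubleton_eq_imageE[OF 1(2) this inj_place(1)] 1(1) show ?thesis by metis
  next
    case 2
    then have "card e = 2" using assms by (auto simp: diagrams_def)
    from doubleton_eq_imageE[OF 2(2) this inj_place(2)] 2(1) show ?thesis by metis
  qed
next
  assume ?r
  then show ?l
    using stack_below stack_above by metis
qed

lemma linked_refl [simp]: "(u, u) \<in> linked b1 b2"
  by (simp add: linked_def)

lemma linked_sym: "(u, v) \<in> linked b1 b2 \<Longrightarrow> (v, u) \<in> linked b1 b2"
  using sym_rtrancl[of "{(x, y). {x, y} \<in> stack b1 b2}"]
  unfolding linked_def sym_def by (simp add: insert_commute)

lemma linked_trans [trans]:
  "(u, v) \<in> linked b1 b2 \<Longrightarrow> (v, w) \<in> linked b1 b2 \<Longrightarrow> (u, w) \<in> linked b1 b2"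
  unfolding linked_def by (rule rtrancl_trans)

lemma linked_below: "{x, y} \<in> b1 \<Longrightarrow> (place_below x, place_below y) \<in> linked b1 b2"
  unfolding linked_def by (simp add: stack_below r_into_rtrancl)

lemma linked_above: "{x, y} \<in> b2 \<Longrightarrow> (place_above x, place_above y) \<in> linked b1 b2"
  unfolding linked_def by (simp add: stack_above r_into_rtrancl)

text \<open>The partner map of the lower diagram, extended by the identity to an involution of all
  vertices. Together with \<open>step_above\<close> it turns components of the stacked graph into
  orbits, with the outer vertices as fixed points.\<close>

fun step_below :: "nat \<Rightarrow> diagram \<Rightarrow> vertex \<Rightarrow> vertex" where
  "step_below n b (Bot i) = (if i \<in> {1..n} then place_below (partner b (Lower i)) else Bot i)"
| "step_below n b (Mid i) = (if i \<in> {1..n} then place_below (partner b (Upper i)) else Mid i)"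
| "step_below n b (Top i) = Top i"

fun step_above :: "nat \<Rightarrow> diagram \<Rightarrow> vertex \<Rightarrow> vertex" where
  "step_above n b (Bot i) = Bot i"
| "step_above n b (Mid i) = (if i \<in> {1..n} then place_above (partner b (Lower i)) else Mid i)"
| "step_above n b (Top i) = (if i \<in> {1..n} then place_above (partner b (Upper i)) else Top i)"

lemma step_place [simp]:
  "x \<in> nodes n \<Longrightarrow> step_below n b (place_below x) = place_below (partner b x)"
  "x \<in> nodes n \<Longrightarrow> step_above n b (place_above x) = place_above (partner b x)"
  by (cases x; simp)+

lemma step_cases:
  "step_below n b v = v \<or> (\<exists>x\<in>nodes n. v = place_below x)"
  "step_above n b v = v \<or> (\<exists>x\<in>nodes n. v = place_above x)"
  by (cases v; metis in_nodes_iff place_below.simps step_below.simps place_above.simps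
      step_above.simps atLeastAtMost_iff)+

lemma step_step:
  assumes "b \<in> diagrams n"
  shows "step_below n b (step_below n b v) = v" "step_above n b (step_above n b v) = v"
  using step_cases(1)[of n b v] step_cases(2)[of n b v] partner_in_nodes[OF assms]
    partner_partner[OF assms] by (metis step_place)+

text \<open>Passing from edges to total steps adds only pairs \<open>(u, u)\<close>, which the
  reflexive closure absorbs.\<close>

lemma linked_eq_steps:
  assumes "b1 \<in> diagrams n" "b2 \<in> diagrams n"
  shows "linked b1 b2 = {(u, v). v = step_below n b1 u \<or> v = step_above n b2 u}\<^sup>*" (is "_ = ?R\<^sup>*")
proof -
  have "v = step_below n b1 u \<or> v = step_above n b2 u" if "{u, v} \<in> stack b1 b2" for u v
    using that by (auto simp: stack_edge_iff[OF assms] edge_iff[OF assms(1)] edge_iff[OF assms(2)])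
  moreover have "u = step_below n b1 u \<or> {u, step_below n b1 u} \<in> stack b1 b2" for u
    using stack_below[OF partner_edge[OF assms(1)], of "Lower _"]
      stack_below[OF partner_edge[OF assms(1)], of "Upper _"] by (cases u) auto
  moreover have "u = step_above n b2 u \<or> {u, step_above n b2 u} \<in> stack b1 b2" for u
    using stack_above[OF partner_edge[OF assms(2)], of "Lower _"]
      stack_above[OF partner_edge[OF assms(2)], of "Upper _"] by (cases u) auto
  ultimately have "{(u, v). {u, v} \<in> stack b1 b2} \<subseteq> ?R" "?R \<subseteq> {(u, v). {u, v} \<in> stack b1 b2}\<^sup>="
    by auto
  then have "?R\<^sup>* = {(u, v). {u, v} \<in> stack b1 b2}\<^sup>*"
    by (intro rtrancl_subset) auto
  then show ?thesis by (simp add: linked_def)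
qed

text \<open>Within \<open>?V\<close>, exactly the top vertices are fixed by
  \<open>step_below\<close> and exactly the bottom ones by \<open>step_above\<close>; middle
  vertices are fixed by neither. So the component of an outer vertex is a path, and its other end is
  the required node.\<close>

lemma linked_outer_unique:
  assumes b: "b1 \<in> diagrams n" "b2 \<in> diagrams n" and x: "x \<in> nodes n"
  shows "\<exists>!y. y \<in> nodes n \<and> y \<noteq> x \<and> (outer x, outer y) \<in> linked b1 b2"
proof -
  let ?g = "step_below n b1" and ?h = "step_above n b2"
  let ?V = "place_below ` nodes n \<union> place_above ` nodes n"
  define K where "K = linked b1 b2 `` {outer x}"
  have in_V: "place_below z \<in> ?V" "place_above z \<in> ?V" if "z \<in> nodes n" for z
    using that by auto
  have outer_in_V: "outer z \<in> ?V" if "z \<in> nodes n" for z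
    using in_V[OF that] by (cases z) auto
  have steps: "?g v \<in> ?V \<and> ?h v \<in> ?V" if "v \<in> ?V" for v
  proof -
    have "?g v = v \<or> (\<exists>z\<in>nodes n. ?g v = place_below z)"
      using step_cases(1)[of n b1 v] partner_in_nodes[OF b(1)] by auto
    moreover have "?h v = v \<or> (\<exists>z\<in>nodes n. ?h v = place_above z)"
      using step_cases(2)[of n b2 v] partner_in_nodes[OF b(2)] by auto
    ultimately show ?thesis using that in_V by metis
  qed
  have "(outer x, v) \<in> linked b1 b2 \<Longrightarrow> v \<in> ?V" for v
    unfolding linked_eq_steps[OF b]
  proof (induction rule: rtrancl_induct)
    case base
    show ?case using outer_in_V[OF x] .
  next
    case (step u v)
    then show ?case using steps[of u] by auto
  qed
  then have KV: "K \<subseteq> ?V" by (auto simp: K_def)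
  then have fin: "finite K" by (rule finite_subset) simp
  have fixed: "(?g v = v \<longleftrightarrow> v \<in> range Top) \<and> (?h v = v \<longleftrightarrow> v \<in> range Bot)" if v: "v \<in> ?V" for v
  proof -
    have nb: "place_below (partner b1 z) \<noteq> place_below z" if "z \<in> nodes n" for z
      using partner_neq[OF b(1) that] inj_place(1) by (auto dest: injD)
    have na: "place_above (partner b2 z) \<noteq> place_above z" if "z \<in> nodes n" for z
      using partner_neq[OF b(2) that] inj_place(2) by (auto dest: injD)
    consider i where "v = Bot i" "i \<in> {1..n}" | i where "v = Mid i" "i \<in> {1..n}"
      | i where "v = Top i" "i \<in> {1..n}"
      using v by (auto simp: nodes_def)
    then show ?thesis
    proof cases
      case 1
      then show ?thesis using nb[of "Lower i"] by auto
    next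
      case 2
      then show ?thesis using nb[of "Upper i"] na[of "Lower i"] by auto
    next
      case 3
      then show ?thesis using na[of "Upper i"] by auto
    qed
  qed
  have outer_iff: "v \<in> range Top \<or> v \<in> range Bot \<longleftrightarrow> (\<exists>z\<in>nodes n. v = outer z)" if "v \<in> ?V" for v
  proof
    assume "v \<in> range Top \<or> v \<in> range Bot"
    then obtain i where "v = outer (Upper i) \<and> Upper i \<in> nodes n \<or> v = outer (Lower i) \<and> Lower i \<in> nodes n"
      using \<open>v \<in> ?V\<close> by (auto simp: nodes_def)
    then show "\<exists>z\<in>nodes n. v = outer z" by blast
  next
    assume "\<exists>z\<in>nodes n. v = outer z"
    then show "v \<in> range Top \<or> v \<in> range Bot" by (metis outer.elims rangeI)
  qed
  have "\<exists>!v. v \<in> K \<and> v \<noteq> outer x \<and> (?g v = v \<or> ?h v = v)"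
  proof (cases x)
    case (Upper i)
    show ?thesis
    proof (rule involutions_orbit_fixed)
      show "K = {(u, v). v = ?g u \<or> v = ?h u}\<^sup>* `` {outer x}" by (simp add: K_def linked_eq_steps[OF b])
      show "\<not> (?g v = v \<and> ?h v = v)" if "v \<in> K" for v using fixed[of v] that KV by auto
    qed (use step_step b fin Upper in auto)
  next
    \<comment> \<open>A start in the lower row is fixed by \<open>step_above\<close> instead of
      \<open>step_below\<close>, so the two involutions exchange roles.\<close>
    case (Lower i)
    have "\<exists>!v. v \<in> K \<and> v \<noteq> outer x \<and> (?h v = v \<or> ?g v = v)"
    proof (rule involutions_orbit_fixed)
      show "K = {(u, v). v = ?h u \<or> v = ?g u}\<^sup>* `` {outer x}"
        by (simp add: K_def linked_eq_steps[OF b] disj_commute)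
      show "\<not> (?h v = v \<and> ?g v = v)" if "v \<in> K" for v using fixed[of v] that KV by auto
    qed (use step_step b fin Lower in auto)
    then show ?thesis by (simp add: disj_commute)
  qed
  moreover have "v \<in> K \<and> v \<noteq> outer x \<and> (?g v = v \<or> ?h v = v) \<longleftrightarrow>
      (\<exists>z\<in>nodes n. v = outer z \<and> z \<noteq> x \<and> (outer x, outer z) \<in> linked b1 b2)" for v
  proof (cases "v \<in> ?V")
    case True
    then have "?g v = v \<or> ?h v = v \<longleftrightarrow> (\<exists>z\<in>nodes n. v = outer z)"
      using fixed[OF True] outer_iff[OF True] by simp
    moreover have "outer z = outer x \<longleftrightarrow> z = x" for z using inj_place(3) by (rule inj_eq)
    ultimately show ?thesis unfolding K_def Image_singleton_iff by metis
  next
    case False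
    then have "v \<notin> K" using KV by (rule contra_subsetD[rotated])
    moreover have "v \<noteq> outer z" if "z \<in> nodes n" for z using outer_in_V[OF that] False by metis
    ultimately show ?thesis by blast
  qed
  ultimately have "\<exists>!v. \<exists>z\<in>nodes n. v = outer z \<and> z \<noteq> x \<and> (outer x, outer z) \<in> linked b1 b2"
    by simp
  then show ?thesis using inj_place(3) by (metis injD)
qed

lemma compose_in_diagrams:
  assumes b: "b1 \<in> diagrams n" "b2 \<in> diagrams n"
  shows "compose_diagrams n b1 b2 \<in> diagrams n"
proof -
  define g where "g x = (THE y. y \<in> nodes n \<and> y \<noteq> x \<and> (outer x, outer y) \<in> linked b1 b2)" for x
  have g: "g x \<in> nodes n" "g x \<noteq> x" "(outer x, outer (g x)) \<in> linked b1 b2" if "x \<in> nodes n" for x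
    using theI'[OF linked_outer_unique[OF b that]] by (auto simp: g_def)
  have gI: "g x = y" if "x \<in> nodes n" "y \<in> nodes n" "y \<noteq> x" "(outer x, outer y) \<in> linked b1 b2" for x y
    using linked_outer_unique[OF b that(1)] g[OF that(1)] that by blast
  have "{{x, g x} | x. x \<in> nodes n} \<in> diagrams n"
  proof (rule involution_diagram)
    fix x assume x: "x \<in> nodes n"
    show "g (g x) = x" using gI[of "g x" x] g[OF x] x linked_sym by metis
  qed (use g in auto)
  moreover have "compose_diagrams n b1 b2 = {{x, g x} | x. x \<in> nodes n}"
  proof
    show "compose_diagrams n b1 b2 \<subseteq> {{x, g x} | x. x \<in> nodes n}"
      using gI unfolding compose_diagrams_def by fastforce
    show "{{x, g x} | x. x \<in> nodes n} \<subseteq> compose_diagrams n b1 b2"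
      using g unfolding compose_diagrams_def by fastforce
  qed
  ultimately show ?thesis by simp
qed

lemma compose_edge:
  "x \<in> nodes n \<Longrightarrow> y \<in> nodes n \<Longrightarrow> x \<noteq> y \<Longrightarrow> (outer x, outer y) \<in> linked b1 b2 \<Longrightarrow>
    {x, y} \<in> compose_diagrams n b1 b2"
  by (auto simp: compose_diagrams_def)

text \<open>As the composition is a matching, exhibiting one link per node determines it; no other
  link has to be excluded.\<close>

lemma compose_eqI:
  assumes "b1 \<in> diagrams n" "b2 \<in> diagrams n" "d \<in> diagrams n"
    and "\<And>x. x \<in> nodes n \<Longrightarrow> (outer x, outer (partner d x)) \<in> linked b1 b2"
  shows "compose_diagrams n b1 b2 = d"
proof -
  have "d = compose_diagrams n b1 b2"
  proof (rule diagram_eqI[OF assms(3) compose_in_diagrams[OF assms(1,2)]])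
    fix x assume "x \<in> nodes n"
    then show "{x, partner d x} \<in> compose_diagrams n b1 b2"
      using compose_edge assms(4) partner_in_nodes[OF assms(3)] partner_neq[OF assms(3)] by metis
  qed
  then show ?thesis by simp
qed

section \<open>Invariance of composition under bijections of the vertices\<close>

lemma inj_image_inj: "inj h \<Longrightarrow> inj ((`) h)"
  by (simp add: inj_def inj_image_eq_iff)

lemma rtrancl_map:
  assumes "(x, y) \<in> r\<^sup>*" "\<And>x y. (x, y) \<in> r \<Longrightarrow> (f x, f y) \<in> s"
  shows "(f x, f y) \<in> s\<^sup>*"
  using assms(1) by induction (auto intro: rtrancl_into_rtrancl assms(2))

lemma linked_transport:
  assumes "bij h" "stack c1 c2 = (\<lambda>e. h ` e) ` stack b1 b2"
  shows "(h u, h v) \<in> linked c1 c2 \<longleftrightarrow> (u, v) \<in> linked b1 b2"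
proof -
  have edge: "{h x, h y} \<in> stack c1 c2 \<longleftrightarrow> {x, y} \<in> stack b1 b2" for x y
  proof -
    have "{h x, h y} = h ` {x, y}" by simp
    then show ?thesis
      using assms inj_image_mem_iff[OF inj_image_inj[OF bij_is_inj[OF assms(1)]], of "{x, y}"] by simp
  qed
  have inv_h: "h (inv_fun h x) = x" "inv_fun h (h x) = x" for x
    using assms(1) by (simp_all add: bij_is_surj bij_is_inj surj_f_inv_f)
  show ?thesis
  proof
    assume "(u, v) \<in> linked b1 b2"
    then show "(h u, h v) \<in> linked c1 c2"
      unfolding linked_def by (rule rtrancl_map) (use edge in simp)
  next
    assume "(h u, h v) \<in> linked c1 c2"
    then have "(inv_fun h (h u), inv_fun h (h v)) \<in> linked b1 b2"
      unfolding linked_def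
    proof (rule rtrancl_map)
      fix x y assume "(x, y) \<in> {(x, y). {x, y} \<in> stack c1 c2}"
      then show "(inv_fun h x, inv_fun h y) \<in> {(x, y). {x, y} \<in> stack b1 b2}"
        using edge[of "inv_fun h x" "inv_fun h y"] by (simp add: inv_h)
    qed
    then show "(u, v) \<in> linked b1 b2" by (simp add: inv_h)
  qed
qed

text \<open>Stated for any vertex bijection \<open>h\<close> that induces \<open>g\<close> on the
  outer nodes, so that row permutations and the flip are both instances.\<close>

lemma compose_transport:
  assumes h: "bij h" "stack c1 c2 = (\<lambda>e. h ` e) ` stack b1 b2"
    and g: "bij_betw g (nodes n) (nodes n)" "\<And>x. outer (g x) = h (outer x)"
  shows "compose_diagrams n c1 c2 = relabel g (compose_diagrams n b1 b2)"
proof -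
  have eq: "(outer (g x), outer (g y)) \<in> linked c1 c2 \<longleftrightarrow> (outer x, outer y) \<in> linked b1 b2" for x y
    using linked_transport[OF h] g(2) by simp
  have inj: "g x = g y \<longleftrightarrow> x = y" if "x \<in> nodes n" "y \<in> nodes n" for x y
    using g(1) that by (auto simp: bij_betw_def inj_on_eq_iff)
  show ?thesis
  proof
    show "compose_diagrams n c1 c2 \<subseteq> relabel g (compose_diagrams n b1 b2)"
    proof
      fix e assume "e \<in> compose_diagrams n c1 c2"
      then obtain x' y' where e: "e = {x', y'}" "x' \<in> nodes n" "y' \<in> nodes n" "x' \<noteq> y'"
        "(outer x', outer y') \<in> linked c1 c2" by (auto simp: compose_diagrams_def)
      then obtain x y where "x' = g x" "y' = g y" "x \<in> nodes n" "y \<in> nodes n"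
        using g(1) by (metis bij_betw_imp_surj_on imageE)
      then show "e \<in> relabel g (compose_diagrams n b1 b2)"
        using e eq by (auto intro!: relabel_edge compose_edge)
    qed
    show "relabel g (compose_diagrams n b1 b2) \<subseteq> compose_diagrams n c1 c2"
    proof
      fix e assume "e \<in> relabel g (compose_diagrams n b1 b2)"
      then obtain x y where e: "e = {g x, g y}" "x \<in> nodes n" "y \<in> nodes n" "x \<noteq> y"
        "(outer x, outer y) \<in> linked b1 b2" by (auto simp: compose_diagrams_def relabel_def)
      then have "g x \<in> nodes n" "g y \<in> nodes n" using g(1) by (auto dest: bij_betwE)
      then show "e \<in> compose_diagrams n c1 c2"
        using e eq inj by (auto intro!: compose_edge)
    qed
  qed
qed

lemma num_loops_transport:
  assumes h: "bij h" "stack c1 c2 = (\<lambda>e. h ` e) ` stack b1 b2"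
    and mid: "h ` Mid ` {1..n} = Mid ` {1..n}" "\<And>v. h v \<in> range Mid \<longleftrightarrow> v \<in> range Mid"
  shows "num_loops n c1 c2 = num_loops n b1 b2"
proof -
  have class_eq: "linked c1 c2 `` {h u} = h ` (linked b1 b2 `` {u})" for u
  proof
    show "linked c1 c2 `` {h u} \<subseteq> h ` (linked b1 b2 `` {u})"
    proof
      fix w assume w: "w \<in> linked c1 c2 `` {h u}"
      obtain v where "w = h v" using h(1) by (metis bij_pointE)
      then show "w \<in> h ` (linked b1 b2 `` {u})" using w linked_transport[OF h] by auto
    qed
  qed (use linked_transport[OF h] in auto)
  have "Mid ` {1..n} // linked c1 c2 = (h ` Mid ` {1..n}) // linked c1 c2"
    using mid(1) by simp
  also have "\<dots> = (`) h ` (Mid ` {1..n} // linked b1 b2)"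
    by (auto simp: quotient_def class_eq)
  finally have "{K \<in> Mid ` {1..n} // linked c1 c2. K \<subseteq> range Mid}
      = (`) h ` {K \<in> Mid ` {1..n} // linked b1 b2. K \<subseteq> range Mid}"
    using mid(2) by (auto simp: image_subset_iff)
  moreover have "inj_on ((`) h) X" for X
    using inj_on_subset[OF inj_image_inj[OF bij_is_inj[OF h(1)]]] by blast
  ultimately show ?thesis by (simp add: num_loops_def card_image)
qed

fun vertex_map :: "(nat \<Rightarrow> nat) \<Rightarrow> (nat \<Rightarrow> nat) \<Rightarrow> (nat \<Rightarrow> nat) \<Rightarrow> vertex \<Rightarrow> vertex" where
  "vertex_map p q r (Bot i) = Bot (p i)"
| "vertex_map p q r (Mid i) = Mid (q i)"
| "vertex_map p q r (Top i) = Top (r i)"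

fun vertex_flip :: "vertex \<Rightarrow> vertex" where
  "vertex_flip (Bot i) = Top i"
| "vertex_flip (Mid i) = Mid i"
| "vertex_flip (Top i) = Bot i"

lemma bij_vertex_map:
  assumes "p permutes S" "q permutes S" "r permutes S"
  shows "bij (vertex_map p q r)"
proof (rule o_bij)
  show "vertex_map (inv_fun p) (inv_fun q) (inv_fun r) \<circ> vertex_map p q r = id"
  proof
    fix v show "(vertex_map (inv_fun p) (inv_fun q) (inv_fun r) \<circ> vertex_map p q r) v = id v"
      using assms by (cases v) (auto simp: permutes_inverses)
  qed
  show "vertex_map p q r \<circ> vertex_map (inv_fun p) (inv_fun q) (inv_fun r) = id"
  proof
    fix v show "(vertex_map p q r \<circ> vertex_map (inv_fun p) (inv_fun q) (inv_fun r)) v = id v"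
      using assms by (cases v) (auto simp: permutes_inverses)
  qed
qed

lemma vertex_flip_flip [simp]: "vertex_flip (vertex_flip v) = v"
  by (cases v) auto

lemma bij_vertex_flip: "bij vertex_flip"
  by (rule o_bij[of vertex_flip]) auto

text \<open>The middle row is shared, so the upper permutation of the lower diagram and the lower
  permutation of the upper diagram must be the same \<open>q\<close>.\<close>

lemma stack_node_map:
  "stack (relabel (node_map p q) b1) (relabel (node_map q r) b2) =
    (\<lambda>e. vertex_map p q r ` e) ` stack b1 b2"
proof -
  have "place_below (node_map p q x) = vertex_map p q r (place_below x)"
    "place_above (node_map q r x) = vertex_map p q r (place_above x)" for x
    by (cases x; simp)+
  then show ?thesis by (simp add: stack_def relabel_def image_Un image_image)
qed

lemma stack_swap_row:
  "stack (relabel swap_row b2) (relabel swap_row b1) = (\<lambda>e. vertex_flip ` e) ` stack b1 b2"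
proof -
  have "place_below (swap_row x) = vertex_flip (place_above x)"
    "place_above (swap_row x) = vertex_flip (place_below x)" for x
    by (cases x; simp)+
  then show ?thesis by (simp add: stack_def relabel_def image_Un image_image Un_commute)
qed

lemma
  assumes p: "p permutes {1..n}" "q permutes {1..n}" "r permutes {1..n}"
  shows compose_node_map: "compose_diagrams n (relabel (node_map p q) b1) (relabel (node_map q r) b2) =
      relabel (node_map p r) (compose_diagrams n b1 b2)"
    and num_loops_node_map: "num_loops n (relabel (node_map p q) b1) (relabel (node_map q r) b2) =
      num_loops n b1 b2"
proof -
  note h = bij_vertex_map[OF p] stack_node_map[of p q b1 r b2]
  show "compose_diagrams n (relabel (node_map p q) b1) (relabel (node_map q r) b2) =
      relabel (node_map p r) (compose_diagrams n b1 b2)"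
  proof (rule compose_transport[OF h bij_node_map[OF p(1,3)]])
    show "outer (node_map p r x) = vertex_map p q r (outer x)" for x by (cases x) auto
  qed
  show "num_loops n (relabel (node_map p q) b1) (relabel (node_map q r) b2) = num_loops n b1 b2"
  proof (rule num_loops_transport[OF h])
    have "vertex_map p q r ` Mid ` {1..n} = Mid ` q ` {1..n}" by (simp add: image_image)
    then show "vertex_map p q r ` Mid ` {1..n} = Mid ` {1..n}" by (simp only: permutes_image[OF p(2)])
    show "vertex_map p q r v \<in> range Mid \<longleftrightarrow> v \<in> range Mid" for v by (cases v) auto
  qed
qed

text \<open>Turning the picture with three rows upside down exchanges the two factors and keeps the
  loops: the flip is an anti-automorphism of the Brauer algebra.\<close>

lemma compose_swap_row:
    "compose_diagrams n (relabel swap_row b2) (relabel swap_row b1) =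
      relabel swap_row (compose_diagrams n b1 b2)"
  and num_loops_swap_row:
    "num_loops n (relabel swap_row b2) (relabel swap_row b1) = num_loops n b1 b2"
proof -
  note h = bij_vertex_flip stack_swap_row[of b2 b1]
  show "compose_diagrams n (relabel swap_row b2) (relabel swap_row b1) =
      relabel swap_row (compose_diagrams n b1 b2)"
  proof (rule compose_transport[OF h bij_swap_row])
    show "outer (swap_row x) = vertex_flip (outer x)" for x by (cases x) auto
  qed
  show "num_loops n (relabel swap_row b2) (relabel swap_row b1) = num_loops n b1 b2"
  proof (rule num_loops_transport[OF h])
    show "vertex_flip ` Mid ` {1..n} = Mid ` {1..n}" by (simp add: image_image)
    show "vertex_flip v \<in> range Mid \<longleftrightarrow> v \<in> range Mid" for v by (cases v) auto
  qed
qed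

lemma compose_id:
  assumes b: "b \<in> diagrams n"
  shows "compose_diagrams n b (id_diagram n) = b" "num_loops n b (id_diagram n) = 0"
proof -
  have mid_top: "(Mid i, Top i) \<in> linked b (id_diagram n)" if "i \<in> {1..n}" for i
    using linked_above[of "Lower i" "Upper i" "id_diagram n" b] that by (auto simp: id_diagram_def)
  have outer_place: "(outer x, place_below x) \<in> linked b (id_diagram n)" if "x \<in> nodes n" for x
    using that mid_top linked_sym by (cases x) auto
  show "compose_diagrams n b (id_diagram n) = b"
  proof (rule compose_eqI[OF b id_diagram_in_diagrams b])
    fix x assume x: "x \<in> nodes n"
    have "(outer x, place_below x) \<in> linked b (id_diagram n)" using outer_place x .
    also have "(place_below x, place_below (partner b x)) \<in> linked b (id_diagram n)"
      using linked_below partner_edge[OF b x] .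
    also have "(place_below (partner b x), outer (partner b x)) \<in> linked b (id_diagram n)"
      using linked_sym[OF outer_place[OF partner_in_nodes[OF b x]]] .
    finally show "(outer x, outer (partner b x)) \<in> linked b (id_diagram n)" .
  qed
  \<comment> \<open>The identity diagram links every middle vertex to the top row, so no component
    is a loop.\<close>
  have "\<not> K \<subseteq> range Mid" if "K \<in> Mid ` {1..n} // linked b (id_diagram n)" for K
    using that mid_top by (fastforce simp: quotient_def)
  then show "num_loops n b (id_diagram n) = 0" unfolding num_loops_def by (simp add: card_eq_0_iff)
qed

lemma swap_row_id_diagram [simp]: "relabel swap_row (id_diagram n) = id_diagram n"
  by (auto simp: relabel_def id_diagram_def image_image insert_commute)

lemma id_compose:
  assumes b: "b \<in> diagrams n"
  shows "compose_diagrams n (id_diagram n) b = b" "num_loops n (id_diagram n) b = 0"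
proof -
  have b': "relabel swap_row b \<in> diagrams n" using b by simp
  show "compose_diagrams n (id_diagram n) b = b"
    using compose_id(1)[OF b'] compose_swap_row[of n "id_diagram n" "relabel swap_row b"] by simp
  show "num_loops n (id_diagram n) b = 0"
    using compose_id(2)[OF b'] num_loops_swap_row[of n "id_diagram n" "relabel swap_row b"] by simp
qed

section \<open>Permutations as the diagrams without arcs\<close>

definition perm_diagram :: "nat \<Rightarrow> (nat \<Rightarrow> nat) \<Rightarrow> diagram" where
  "perm_diagram n p = relabel (node_map id p) (id_diagram n)"

text \<open>Permuting both rows by \<open>p\<close> fixes the identity diagram, so \<open>p\<close>
  on the upper row amounts to its inverse on the lower row. This form is the one for multiplication
  from the left, which acts on lower rows.\<close>

lemma perm_diagram_altdef:
  assumes p: "p permutes {1..n}"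
  shows "perm_diagram n p = relabel (node_map (inv_fun p) id) (id_diagram n)"
proof -
  have "relabel (node_map p p) (id_diagram n) = id_diagram n"
  proof -
    have "relabel (node_map p p) (id_diagram n) = (\<lambda>i. {Lower i, Upper i}) ` p ` {1..n}"
      by (simp add: relabel_def id_diagram_def image_image)
    then show ?thesis by (simp only: permutes_image[OF p] id_diagram_def)
  qed
  then have "relabel (node_map (inv_fun p) id) (id_diagram n) =
      relabel (node_map (inv_fun p) id) (relabel (node_map p p) (id_diagram n))" by simp
  also have "\<dots> = perm_diagram n p"
    using p by (simp add: relabel_relabel node_map_comp permutes_inv_o perm_diagram_def)
  finally show ?thesis by simp
qed

lemma perm_diagram_in_diagrams: "p permutes {1..n} \<Longrightarrow> perm_diagram n p \<in> diagrams n"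
  unfolding perm_diagram_def using node_map_in_diagrams permutes_id id_diagram_in_diagrams by blast

lemma num_arcs_perm_diagram: "p permutes {1..n} \<Longrightarrow> num_arcs (perm_diagram n p) = 0"
proof -
  assume p: "p permutes {1..n}"
  have "num_arcs (id_diagram n) = 0"
    by (auto simp: num_arcs_def id_diagram_def card_eq_0_iff)
  then show ?thesis
    unfolding perm_diagram_def using num_arcs_node_map[OF permutes_id p] by simp
qed

lemma compose_perm_diagram:
  assumes b: "b \<in> diagrams n" and p: "p permutes {1..n}"
  shows "compose_diagrams n b (perm_diagram n p) = relabel (node_map id p) b"
    "num_loops n b (perm_diagram n p) = 0"
    "compose_diagrams n (perm_diagram n p) b = relabel (node_map (inv_fun p) id) b"
    "num_loops n (perm_diagram n p) b = 0"
proof -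
  have i: "id permutes {1..n}" by (rule permutes_id)
  show "compose_diagrams n b (perm_diagram n p) = relabel (node_map id p) b"
    using compose_node_map[OF i i p, of b "id_diagram n"] compose_id[OF b] by (simp add: perm_diagram_def)
  show "num_loops n b (perm_diagram n p) = 0"
    using num_loops_node_map[OF i i p, of b "id_diagram n"] compose_id[OF b] by (simp add: perm_diagram_def)
  show "compose_diagrams n (perm_diagram n p) b = relabel (node_map (inv_fun p) id) b"
    using compose_node_map[OF permutes_inv[OF p] i i, of "id_diagram n" b] id_compose[OF b]
    by (simp add: perm_diagram_altdef[OF p])
  show "num_loops n (perm_diagram n p) b = 0"
    using num_loops_node_map[OF permutes_inv[OF p] i i, of "id_diagram n" b] id_compose[OF b]
    by (simp add: perm_diagram_altdef[OF p])
qed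

lemma zero_arcs_perm_diagram:
  assumes b: "b \<in> diagrams n" and "num_arcs b = 0"
  obtains p where "p permutes {1..n}" "b = perm_diagram n p"
proof -
  have "arc_nodes Lower n b = {}" using card_arc_nodes(2)[OF b] assms(2) by simp
  then have "partner b (Lower i) \<in> range Upper" if "i \<in> {1..n}" for i
    using that by (cases "partner b (Lower i)") (auto simp: arc_nodes_def)
  then have "\<forall>i. \<exists>j. i \<in> {1..n} \<longrightarrow> partner b (Lower i) = Upper j" by blast
  then obtain p0 where p0: "\<And>i. i \<in> {1..n} \<Longrightarrow> partner b (Lower i) = Upper (p0 i)" by metis
  define p where "p i = (if i \<in> {1..n} then p0 i else i)" for i
  have p: "partner b (Lower i) = Upper (p i)" "p i \<in> {1..n}" if "i \<in> {1..n}" for i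
    using p0[OF that] partner_in_nodes[OF b, of "Lower i"] that by (auto simp: p_def)
  have "inj_on p {1..n}"
  proof (rule inj_onI)
    fix i j assume ij: "i \<in> {1..n}" "j \<in> {1..n}" "p i = p j"
    then have "partner b (Lower i) = partner b (Lower j)" using p by simp
    then show "i = j" using partner_partner[OF b] ij by (metis in_nodes_iff(1) atLeastAtMost_iff node.inject(1))
  qed
  then have "bij_betw p {1..n} {1..n}"
    using p(2) endo_inj_surj[of "{1..n}" p] unfolding bij_betw_def by blast
  then have perm: "p permutes {1..n}" by (intro bij_imp_permutes) (auto simp: p_def)
  have "perm_diagram n p = b"
  proof (rule sym, rule diagram_eqI[OF b perm_diagram_in_diagrams[OF perm]])
    have edge: "{Lower i, Upper (p i)} \<in> perm_diagram n p" if "i \<in> {1..n}" for i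
      using relabel_edge[of "Lower i" "Upper i" "id_diagram n" "node_map id p"] that
      by (auto simp: perm_diagram_def id_diagram_def)
    fix x assume x: "x \<in> nodes n"
    show "{x, partner b x} \<in> perm_diagram n p"
    proof (cases x)
      case (Lower i)
      then show ?thesis using x p edge by simp
    next
      case (Upper j)
      then obtain i where "i \<in> {1..n}" "j = p i"
        using x permutes_image[OF perm] by (metis atLeastAtMost_iff imageE in_nodes_iff(2))
      then show ?thesis using p edge partner_partner[OF b, of "Lower i"] Upper
        by (simp add: insert_commute)
    qed
  qed
  then show thesis using that perm by simp
qed

section \<open>Arcs that survive composition\<close>

lemma arc_nodes_compose:
  assumes b: "b1 \<in> diagrams n" "b2 \<in> diagrams n"
  shows "arc_nodes Lower n b1 \<subseteq> arc_nodes Lower n (compose_diagrams n b1 b2)"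
    and "\<And>i j. {Lower i, Lower j} \<in> b1 \<Longrightarrow> {Lower i, Lower j} \<in> compose_diagrams n b1 b2"
    and "\<And>i j. {Upper i, Upper j} \<in> b2 \<Longrightarrow> {Upper i, Upper j} \<in> compose_diagrams n b1 b2"
proof -
  show lower: "{Lower i, Lower j} \<in> compose_diagrams n b1 b2" if "{Lower i, Lower j} \<in> b1" for i j
    using linked_below[OF that] edge_in_nodes[OF b(1) that] by (intro compose_edge) auto
  show "{Upper i, Upper j} \<in> compose_diagrams n b1 b2" if "{Upper i, Upper j} \<in> b2" for i j
    using linked_above[OF that] edge_in_nodes[OF b(2) that] by (intro compose_edge) auto
  show "arc_nodes Lower n b1 \<subseteq> arc_nodes Lower n (compose_diagrams n b1 b2)"
  proof
    fix i assume "i \<in> arc_nodes Lower n b1"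
    then obtain j where ij: "i \<in> {1..n}" "partner b1 (Lower i) = Lower j" by (auto simp: arc_nodes_def)
    then have "{Lower i, Lower j} \<in> b1" using partner_edge[OF b(1), of "Lower i"] by simp
    then have "partner (compose_diagrams n b1 b2) (Lower i) = Lower j"
      using lower partner_eqI compose_in_diagrams[OF b] by blast
    then show "i \<in> arc_nodes Lower n (compose_diagrams n b1 b2)"
      using ij by (simp add: arc_nodes_def)
  qed
qed

text \<open>The lower arcs of the lower factor have both ends in the outer row and persist in the
  product. With the mirrored statement below, this is why \<open>arc_ideal\<close> is a two-sided
  ideal.\<close>

lemma num_arcs_compose_left:
  assumes b: "b1 \<in> diagrams n" "b2 \<in> diagrams n"
  shows "num_arcs b1 \<le> num_arcs (compose_diagrams n b1 b2)"
proof -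
  have "card (arc_nodes Lower n b1) \<le> card (arc_nodes Lower n (compose_diagrams n b1 b2))"
    by (intro card_mono arc_nodes_compose(1) b) simp
  then show ?thesis using card_arc_nodes(2) b compose_in_diagrams by simp
qed

lemma num_arcs_compose_right:
  assumes b: "b1 \<in> diagrams n" "b2 \<in> diagrams n"
  shows "num_arcs b2 \<le> num_arcs (compose_diagrams n b1 b2)"
  using num_arcs_compose_left[of "relabel swap_row b2" n "relabel swap_row b1"] b
    num_arcs_swap_row compose_in_diagrams[OF b] by (simp add: compose_swap_row)

section \<open>The centraliser\<close>

text \<open>An iterated sum with a conditional in place of a sum over pairs, so that each factor can
  be reindexed on its own.\<close>

lemma brauer_mult:
  "(a \<otimes>\<^bsub>brauer n \<delta>\<^esub> a') d = (\<Sum>b1\<in>diagrams n. \<Sum>b2\<in>diagrams n.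
     if compose_diagrams n b1 b2 = d then a b1 * a' b2 * \<delta> ^ num_loops n b1 b2 else 0)"
proof -
  have "(a \<otimes>\<^bsub>brauer n \<delta>\<^esub> a') d =
      (\<Sum>(b1, b2) \<in> {z \<in> diagrams n \<times> diagrams n. compose_diagrams n (fst z) (snd z) = d}.
        a b1 * a' b2 * \<delta> ^ num_loops n b1 b2)"
    unfolding brauer_def by (auto intro!: sum.cong)
  also have "\<dots> = (\<Sum>z \<in> diagrams n \<times> diagrams n. if compose_diagrams n (fst z) (snd z) = d
      then a (fst z) * a' (snd z) * \<delta> ^ num_loops n (fst z) (snd z) else 0)"
    by (subst sum.inter_filter) (auto simp: finite_diagrams intro!: sum.cong)
  finally show ?thesis by (simp add: sum.cartesian_product case_prod_beta)
qed

lemma brauer_mult_outside: "d \<notin> diagrams n \<Longrightarrow> (a \<otimes>\<^bsub>brauer n \<delta>\<^esub> a') d = 0"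
  unfolding brauer_mult using compose_in_diagrams by (auto intro!: sum.neutral)

lemma centraliser_simps [simp]:
  "x \<otimes>\<^bsub>centraliser_algebra n \<delta>\<^esub> y = x \<otimes>\<^bsub>brauer n \<delta>\<^esub> y"
  "x \<oplus>\<^bsub>centraliser_algebra n \<delta>\<^esub> y = (\<lambda>b. x b + y b)"
  by (simp_all add: centraliser_algebra_def brauer_def)

section \<open>Centraliser and conjugation invariance\<close>

definition conj_invariant :: "nat \<Rightarrow> (diagram \<Rightarrow> complex) \<Rightarrow> bool" where
  "conj_invariant n a \<longleftrightarrow>
     (\<forall>p. p permutes {1..n} \<longrightarrow> (\<forall>b\<in>diagrams n. a (relabel (node_map p p) b) = a b))"

lemma conj_invariantD:
  "conj_invariant n a \<Longrightarrow> p permutes {1..n} \<Longrightarrow> b \<in> diagrams n \<Longrightarrow> a (relabel (node_map p p) b) = a b"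
  by (simp add: conj_invariant_def)

lemma relabel_eq_iff:
  assumes "p permutes {1..n}" "q permutes {1..n}"
  shows "relabel (node_map p q) b = d \<longleftrightarrow> b = relabel (node_map (inv_fun p) (inv_fun q)) d"
  using relabel_node_map_inv[OF assms] by metis

text \<open>Composing with a permutation diagram permutes the diagrams and closes no loops, so each
  sum has a single term.\<close>

lemma mult_perm_diagram:
  assumes p: "p permutes {1..n}" and d: "d \<in> diagrams n"
  shows "(\<Sum>b\<in>diagrams n. if compose_diagrams n b (perm_diagram n p) = d
      then a b * \<delta> ^ num_loops n b (perm_diagram n p) else (0::complex)) =
      a (relabel (node_map id (inv_fun p)) d)"
    and "(\<Sum>b\<in>diagrams n. if compose_diagrams n (perm_diagram n p) b = d
      then a b * \<delta> ^ num_loops n (perm_diagram n p) b else (0::complex)) =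
      a (relabel (node_map p id) d)"
proof -
  have i: "id permutes {1..n}" and p': "inv_fun p permutes {1..n}"
    using p permutes_id permutes_inv by auto
  have "(\<Sum>b\<in>diagrams n. if compose_diagrams n b (perm_diagram n p) = d
      then a b * \<delta> ^ num_loops n b (perm_diagram n p) else 0) =
      (\<Sum>b\<in>diagrams n. if b = relabel (node_map id (inv_fun p)) d then a b else 0)"
  proof (rule sum.cong[OF refl])
    fix b assume b: "b \<in> diagrams n"
    show "(if compose_diagrams n b (perm_diagram n p) = d
        then a b * \<delta> ^ num_loops n b (perm_diagram n p) else 0) =
        (if b = relabel (node_map id (inv_fun p)) d then a b else 0)"
      using relabel_eq_iff[OF i p, of b d] by (simp only: compose_perm_diagram[OF b p]) simp
  qed
  then show "(\<Sum>b\<in>diagrams n. if compose_diagrams n b (perm_diagram n p) = d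
      then a b * \<delta> ^ num_loops n b (perm_diagram n p) else (0::complex)) =
      a (relabel (node_map id (inv_fun p)) d)"
    using node_map_in_diagrams[OF i p' d] by (simp add: finite_diagrams)
  have "(\<Sum>b\<in>diagrams n. if compose_diagrams n (perm_diagram n p) b = d
      then a b * \<delta> ^ num_loops n (perm_diagram n p) b else 0) =
      (\<Sum>b\<in>diagrams n. if b = relabel (node_map p id) d then a b else 0)"
  proof (rule sum.cong[OF refl])
    fix b assume b: "b \<in> diagrams n"
    show "(if compose_diagrams n (perm_diagram n p) b = d
        then a b * \<delta> ^ num_loops n (perm_diagram n p) b else 0) =
        (if b = relabel (node_map p id) d then a b else 0)"
      using relabel_eq_iff[OF p' i, of b d] permutes_inv_inv[OF p]
      by (simp only: compose_perm_diagram[OF b p]) simp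
  qed
  then show "(\<Sum>b\<in>diagrams n. if compose_diagrams n (perm_diagram n p) b = d
      then a b * \<delta> ^ num_loops n (perm_diagram n p) b else (0::complex)) =
      a (relabel (node_map p id) d)"
    using node_map_in_diagrams[OF p i d] by (simp add: finite_diagrams)
qed

text \<open>Commuting with the group algebra means commuting with every permutation diagram. By
  \<open>mult_perm_diagram\<close> this compares \<open>a\<close> at two one-sided translates of
  \<open>d\<close>, and these are conjugate to each other by \<open>p\<close>.\<close>

lemma centraliser_iff:
  "a \<in> carrier (centraliser_algebra n \<delta>) \<longleftrightarrow> a \<in> diagram_span (diagrams n) \<and> conj_invariant n a"
proof -
  let ?R = "\<lambda>b d. \<Sum>b1\<in>diagrams n. if compose_diagrams n b1 b = d
      then a b1 * \<delta> ^ num_loops n b1 b else 0"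
  let ?L = "\<lambda>b d. \<Sum>b1\<in>diagrams n. if compose_diagrams n b b1 = d
      then a b1 * \<delta> ^ num_loops n b b1 else 0"
  have R: "(a \<otimes>\<^bsub>brauer n \<delta>\<^esub> s) d = (\<Sum>b\<in>diagrams n. s b * ?R b d)" for s d
    unfolding brauer_mult
    by (subst sum.swap) (auto simp: sum_distrib_left intro!: sum.cong)
  have L: "(s \<otimes>\<^bsub>brauer n \<delta>\<^esub> a) d = (\<Sum>b\<in>diagrams n. s b * ?L b d)" for s d
    unfolding brauer_mult by (auto simp: sum_distrib_left intro!: sum.cong)
  have i: "id permutes {1..n}" by (rule permutes_id)
  have "conj_invariant n a \<longleftrightarrow>
      (\<forall>s \<in> symmetric_group_algebra n. a \<otimes>\<^bsub>brauer n \<delta>\<^esub> s = s \<otimes>\<^bsub>brauer n \<delta>\<^esub> a)"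
  proof
    assume inv: "conj_invariant n a"
    show "\<forall>s \<in> symmetric_group_algebra n. a \<otimes>\<^bsub>brauer n \<delta>\<^esub> s = s \<otimes>\<^bsub>brauer n \<delta>\<^esub> a"
    proof (intro ballI ext)
      fix s d assume s: "s \<in> symmetric_group_algebra n"
      show "(a \<otimes>\<^bsub>brauer n \<delta>\<^esub> s) d = (s \<otimes>\<^bsub>brauer n \<delta>\<^esub> a) d"
      proof (cases "d \<in> diagrams n")
        case True
        have "s b * ?R b d = s b * ?L b d" if b: "b \<in> diagrams n" for b
        proof (cases "num_arcs b = 0")
          case False
          then show ?thesis using s b by (simp add: symmetric_group_algebra_def diagram_span_def)
        next
          case 0: True
          obtain p where p: "p permutes {1..n}" "b = perm_diagram n p"
            using zero_arcs_perm_diagram[OF b 0] .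
          have "relabel (node_map p id) d =
              relabel (node_map p p) (relabel (node_map id (inv_fun p)) d)"
            using p(1) by (simp add: relabel_relabel node_map_comp permutes_inv_o)
          then show ?thesis
            using conj_invariantD[OF inv p(1) node_map_in_diagrams[OF i permutes_inv[OF p(1)] True]]
              mult_perm_diagram[OF p(1) True, of a \<delta>] unfolding p(2) by simp
        qed
        then show ?thesis unfolding R L by (rule sum.cong[OF refl])
      next
        case False
        then show ?thesis by (simp add: brauer_mult_outside)
      qed
    qed
  next
    assume comm: "\<forall>s \<in> symmetric_group_algebra n. a \<otimes>\<^bsub>brauer n \<delta>\<^esub> s = s \<otimes>\<^bsub>brauer n \<delta>\<^esub> a"
    show "conj_invariant n a"
      unfolding conj_invariant_def
    proof (intro allI impI ballI)
      fix p b assume p: "p permutes {1..n}" and b: "b \<in> diagrams n"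
      define s where "s c = (if c = perm_diagram n p then 1 else 0 :: complex)" for c
      \<comment> \<open>Chosen so that the two translates of \<open>d\<close> become
        \<open>b\<close> and its conjugate by \<open>p\<close>.\<close>
      define d where "d = relabel (node_map id p) b"
      have d: "d \<in> diagrams n" unfolding d_def using node_map_in_diagrams[OF i p b] .
      have "s \<in> symmetric_group_algebra n"
        using perm_diagram_in_diagrams[OF p] num_arcs_perm_diagram[OF p]
        by (auto simp: symmetric_group_algebra_def diagram_span_def s_def)
      then have "(a \<otimes>\<^bsub>brauer n \<delta>\<^esub> s) d = (s \<otimes>\<^bsub>brauer n \<delta>\<^esub> a) d" using comm by simp
      moreover have "(\<Sum>c\<in>diagrams n. s c * f c) = f (perm_diagram n p)" for f
        using perm_diagram_in_diagrams[OF p]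
        by (simp add: s_def if_distrib[of "\<lambda>x. x * _"] finite_diagrams cong: if_cong)
      ultimately have "a (relabel (node_map id (inv_fun p)) d) = a (relabel (node_map p id) d)"
        unfolding R L using mult_perm_diagram[OF p d, of a \<delta>] by simp
      then show "a (relabel (node_map p p) b) = a b"
        using p by (simp add: d_def relabel_relabel node_map_comp permutes_inv_o)
    qed
  qed
  then show ?thesis by (simp add: centraliser_algebra_def brauer_def)
qed

lemma bij_relabel_node_map:
  assumes "p permutes {1..n}"
  shows "bij_betw (relabel (node_map p p)) (diagrams n) (diagrams n)"
  by (rule bij_betw_byWitness[where f' = "relabel (node_map (inv_fun p) (inv_fun p))"])
    (use relabel_node_map_inv[OF assms assms] node_map_in_diagrams[OF assms assms]
      node_map_in_diagrams[OF permutes_inv[OF assms] permutes_inv[OF assms]] in auto)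

lemma bij_relabel_swap_row: "bij_betw (relabel swap_row) (diagrams n) (diagrams n)"
  by (rule bij_betw_byWitness[where f' = "relabel swap_row"]) auto

text \<open>Conjugation is an automorphism: relabelling both factors and the product by the same
  \<open>p\<close> keeps compositions and loop numbers.\<close>

lemma mult_conj_invariant:
  assumes x: "conj_invariant n x" and y: "conj_invariant n y"
  shows "conj_invariant n (x \<otimes>\<^bsub>brauer n \<delta>\<^esub> y)"
  unfolding conj_invariant_def
proof (intro allI impI ballI)
  fix p d assume p: "p permutes {1..n}" and d: "d \<in> diagrams n"
  let ?r = "relabel (node_map p p)"
  have "(x \<otimes>\<^bsub>brauer n \<delta>\<^esub> y) (?r d) = (\<Sum>b1\<in>diagrams n. \<Sum>b2\<in>diagrams n.
      if compose_diagrams n (?r b1) (?r b2) = ?r d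
      then x (?r b1) * y (?r b2) * \<delta> ^ num_loops n (?r b1) (?r b2) else 0)"
    unfolding brauer_mult
    by (subst sum.reindex_bij_betw[OF bij_relabel_node_map[OF p], symmetric],
        subst (2) sum.reindex_bij_betw[OF bij_relabel_node_map[OF p], symmetric]) simp
  also have "\<dots> = (x \<otimes>\<^bsub>brauer n \<delta>\<^esub> y) d"
    unfolding brauer_mult compose_node_map[OF p p p] num_loops_node_map[OF p p p]
    using conj_invariantD[OF x p] conj_invariantD[OF y p] relabel_node_map_inv[OF p p]
    by (intro sum.cong refl if_cong) (metis, auto)
  finally show "(x \<otimes>\<^bsub>brauer n \<delta>\<^esub> y) (?r d) = (x \<otimes>\<^bsub>brauer n \<delta>\<^esub> y) d" .
qed

lemma mult_swap_row:
  "(x \<otimes>\<^bsub>brauer n \<delta>\<^esub> y) (relabel swap_row d) =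
    ((\<lambda>b. y (relabel swap_row b)) \<otimes>\<^bsub>brauer n \<delta>\<^esub> (\<lambda>b. x (relabel swap_row b))) d"
proof -
  let ?r = "relabel swap_row"
  have inj: "?r b = ?r c \<longleftrightarrow> b = c" for b c by (metis relabel_swap_row_swap_row)
  have "(x \<otimes>\<^bsub>brauer n \<delta>\<^esub> y) (?r d) = (\<Sum>b1\<in>diagrams n. \<Sum>b2\<in>diagrams n.
      if compose_diagrams n (?r b1) (?r b2) = ?r d
      then x (?r b1) * y (?r b2) * \<delta> ^ num_loops n (?r b1) (?r b2) else 0)"
    unfolding brauer_mult
    by (subst sum.reindex_bij_betw[OF bij_relabel_swap_row, symmetric],
        subst (2) sum.reindex_bij_betw[OF bij_relabel_swap_row, symmetric]) simp
  also have "\<dots> = ((\<lambda>b. y (?r b)) \<otimes>\<^bsub>brauer n \<delta>\<^esub> (\<lambda>b. x (?r b))) d"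
    unfolding brauer_mult compose_swap_row num_loops_swap_row inj
    by (subst sum.swap) (simp add: mult.commute cong: if_cong)
  finally show ?thesis .
qed

section \<open>Commutativity from invariance under the flip\<close>

definition flip_conjugate :: "nat \<Rightarrow> diagram \<Rightarrow> bool" where
  "flip_conjugate n b \<longleftrightarrow> (\<exists>p. p permutes {1..n} \<and> relabel (node_map p p) b = relabel swap_row b)"

lemma flip_conjugateD:
  "flip_conjugate n b \<Longrightarrow> conj_invariant n x \<Longrightarrow> b \<in> diagrams n \<Longrightarrow> x (relabel swap_row b) = x b"
  unfolding flip_conjugate_def using conj_invariantD by metis

text \<open>This is Gelfand's trick: the flip is an anti-automorphism.\<close>

lemma mult_commute_at:
  assumes d: "d \<in> diagrams n"
    and xy: "\<And>b. b \<in> diagrams n \<Longrightarrow> num_arcs b \<le> num_arcs d \<Longrightarrow>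
      x (relabel swap_row b) = x b \<and> y (relabel swap_row b) = y b"
    and prod: "(x \<otimes>\<^bsub>brauer n \<delta>\<^esub> y) (relabel swap_row d) = (x \<otimes>\<^bsub>brauer n \<delta>\<^esub> y) d"
  shows "(x \<otimes>\<^bsub>brauer n \<delta>\<^esub> y) d = (y \<otimes>\<^bsub>brauer n \<delta>\<^esub> x) d"
proof -
  have "(x \<otimes>\<^bsub>brauer n \<delta>\<^esub> y) d =
      ((\<lambda>b. y (relabel swap_row b)) \<otimes>\<^bsub>brauer n \<delta>\<^esub> (\<lambda>b. x (relabel swap_row b))) d"
    using prod mult_swap_row by simp
  \<comment> \<open>Factors of \<open>d\<close> have at most as many arcs as \<open>d\<close>, so
    the assumption on \<open>x\<close> and \<open>y\<close> covers every term. This bound is what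
    lets the argument work modulo an ideal.\<close>
  also have "\<dots> = (y \<otimes>\<^bsub>brauer n \<delta>\<^esub> x) d"
    unfolding brauer_mult
    using num_arcs_compose_left num_arcs_compose_right by (intro sum.cong refl if_cong) (auto simp: xy)
  finally show ?thesis .
qed

lemma mult_arc_ideal:
  assumes "b \<in> diagrams n" "num_arcs b < f" "x \<in> arc_ideal n f"
  shows "(x \<otimes>\<^bsub>brauer n \<delta>\<^esub> y) b = 0"
  unfolding brauer_mult
proof (intro sum.neutral ballI)
  fix b1 b2 assume b: "b1 \<in> diagrams n" "b2 \<in> diagrams n"
  show "(if compose_diagrams n b1 b2 = b then x b1 * y b2 * \<delta> ^ num_loops n b1 b2 else 0) = 0"
    using assms num_arcs_compose_left[OF b] by (auto simp: arc_ideal_def diagram_span_def)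
qed

lemma centraliser_ideal_iff:
  "x \<in> centraliser_ideal n \<delta> f \<longleftrightarrow> conj_invariant n x \<and> x \<in> arc_ideal n f"
  by (auto simp: centraliser_ideal_def centraliser_iff arc_ideal_def diagram_span_def)

text \<open>Coefficients at diagrams with fewer than \<open>f\<close> arcs vanish, and the flip
  keeps the number of arcs, so elements of the ideal are invariant under the flip
  everywhere.\<close>

lemma commutative_centraliser_ideal:
  assumes flip: "\<And>b. b \<in> diagrams n \<Longrightarrow> f \<le> num_arcs b \<Longrightarrow> flip_conjugate n b"
  shows "commutative ((centraliser_algebra n \<delta>)\<lparr>carrier := centraliser_ideal n \<delta> f\<rparr>)"
proof -
  have flip_eq: "x (relabel swap_row b) = x b" if "x \<in> centraliser_ideal n \<delta> f" "b \<in> diagrams n" for x b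
  proof (cases "f \<le> num_arcs b")
    case True
    then show ?thesis using flip_conjugateD[OF flip] that by (auto simp: centraliser_ideal_iff)
  next
    case False
    then show ?thesis using that num_arcs_swap_row[of b n]
      by (auto simp: centraliser_ideal_iff arc_ideal_def diagram_span_def)
  qed
  have "(x \<otimes>\<^bsub>brauer n \<delta>\<^esub> y) d = (y \<otimes>\<^bsub>brauer n \<delta>\<^esub> x) d"
    if x: "x \<in> centraliser_ideal n \<delta> f" and y: "y \<in> centraliser_ideal n \<delta> f" for x y d
  proof (cases "d \<in> diagrams n")
    case True
    show ?thesis
    proof (rule mult_commute_at[OF True])
      show "(x \<otimes>\<^bsub>brauer n \<delta>\<^esub> y) (relabel swap_row d) = (x \<otimes>\<^bsub>brauer n \<delta>\<^esub> y) d"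
      proof (cases "f \<le> num_arcs d")
        case f: True
        have "conj_invariant n (x \<otimes>\<^bsub>brauer n \<delta>\<^esub> y)"
          using mult_conj_invariant x y by (simp add: centraliser_ideal_iff)
        then show ?thesis using flip_conjugateD[OF flip[OF True f]] True by blast
      next
        case False
        then show ?thesis
          using x True num_arcs_swap_row[OF True] mult_arc_ideal[of _ n f x \<delta> y]
          by (simp add: centraliser_ideal_iff)
      qed
    qed (use flip_eq x y in auto)
  next
    case False
    then show ?thesis by (simp add: brauer_mult_outside)
  qed
  then show ?thesis by (auto simp: commutative_def)
qed

lemma centraliser_ideal_0: "centraliser_ideal n \<delta> 0 = carrier (centraliser_algebra n \<delta>)"
  by (auto simp: centraliser_ideal_def arc_ideal_def centraliser_iff)

lemma commutative_centraliser_iff_ideal: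
  "commutative (centraliser_algebra n \<delta>) \<longleftrightarrow>
    commutative ((centraliser_algebra n \<delta>)\<lparr>carrier := centraliser_ideal n \<delta> 0\<rparr>)"
  by (simp add: commutative_def centraliser_ideal_0)

section \<open>Quotients by the ideals\<close>

lemma coset_eq:
  "centraliser_ideal n \<delta> f +>\<^bsub>centraliser_algebra n \<delta>\<^esub> x = {\<lambda>b. h b + x b | h. h \<in> centraliser_ideal n \<delta> f}"
  by (auto simp: a_r_coset_def')

text \<open>The product of cosets is literally a union over all pairs of representatives. Arguing
  with this union directly bypasses the axioms of rings and ideals.\<close>

lemma quotient_simps:
  "X \<otimes>\<^bsub>centraliser_algebra n \<delta> Quot I\<^esub> Y = (\<Union>x\<in>X. \<Union>y\<in>Y. I +>\<^bsub>centraliser_algebra n \<delta>\<^esub> (x \<otimes>\<^bsub>brauer n \<delta>\<^esub> y))"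
  "carrier (centraliser_algebra n \<delta> Quot I) =
    {I +>\<^bsub>centraliser_algebra n \<delta>\<^esub> x | x. x \<in> carrier (centraliser_algebra n \<delta>)}"
  by (auto simp: FactRing_def rcoset_mult_def A_RCOSETS_def')

lemma centraliser_ideal_add:
  "x \<in> centraliser_ideal n \<delta> f \<Longrightarrow> y \<in> centraliser_ideal n \<delta> f \<Longrightarrow> (\<lambda>b. x b + y b) \<in> centraliser_ideal n \<delta> f"
  by (auto simp: centraliser_ideal_iff arc_ideal_def diagram_span_def conj_invariant_def)

lemma centraliser_ideal_diff:
  assumes "x \<in> carrier (centraliser_algebra n \<delta>)" "y \<in> carrier (centraliser_algebra n \<delta>)"
    "\<And>b. b \<in> diagrams n \<Longrightarrow> num_arcs b < f \<Longrightarrow> x b = y b"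
  shows "(\<lambda>b. x b - y b) \<in> centraliser_ideal n \<delta> f"
proof -
  have "x b - y b = 0" if "b \<notin> {b \<in> diagrams n. f \<le> num_arcs b}" for b
    using assms that by (cases "b \<in> diagrams n") (auto simp: centraliser_iff diagram_span_def)
  then show ?thesis
    using assms(1,2) by (auto simp: centraliser_ideal_iff centraliser_iff arc_ideal_def
        diagram_span_def conj_invariant_def)
qed

lemma coset_eqI:
  assumes "x \<in> carrier (centraliser_algebra n \<delta>)" "y \<in> carrier (centraliser_algebra n \<delta>)"
    "\<And>b. b \<in> diagrams n \<Longrightarrow> num_arcs b < f \<Longrightarrow> x b = y b"
  shows "centraliser_ideal n \<delta> f +>\<^bsub>centraliser_algebra n \<delta>\<^esub> x =
    centraliser_ideal n \<delta> f +>\<^bsub>centraliser_algebra n \<delta>\<^esub> y"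
proof -
  have "{\<lambda>b. h b + x b | h. h \<in> centraliser_ideal n \<delta> f} \<subseteq> {\<lambda>b. h b + y b | h. h \<in> centraliser_ideal n \<delta> f}"
    if "(\<lambda>b. x b - y b) \<in> centraliser_ideal n \<delta> f" for x y
  proof
    fix z assume "z \<in> {\<lambda>b. h b + x b | h. h \<in> centraliser_ideal n \<delta> f}"
    then obtain h where h: "z = (\<lambda>b. h b + x b)" "h \<in> centraliser_ideal n \<delta> f" by auto
    then have "(\<lambda>b. h b + (x b - y b)) \<in> centraliser_ideal n \<delta> f"
      using centraliser_ideal_add that by blast
    then show "z \<in> {\<lambda>b. h b + y b | h. h \<in> centraliser_ideal n \<delta> f}"
      using h(1) by (intro CollectI exI[of _ "\<lambda>b. h b + (x b - y b)"]) auto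
  qed
  then show ?thesis
    unfolding coset_eq using centraliser_ideal_diff[of x n \<delta> y f] centraliser_ideal_diff[of y n \<delta> x f] assms
    by (intro equalityI) simp_all
qed

lemma centraliser_mult_closed:
  "x \<in> carrier (centraliser_algebra n \<delta>) \<Longrightarrow> y \<in> carrier (centraliser_algebra n \<delta>) \<Longrightarrow>
    x \<otimes>\<^bsub>brauer n \<delta>\<^esub> y \<in> carrier (centraliser_algebra n \<delta>)"
  using mult_conj_invariant brauer_mult_outside by (simp add: centraliser_iff diagram_span_def)

lemma coset_memD:
  assumes "x \<in> carrier (centraliser_algebra n \<delta>)"
    "z \<in> centraliser_ideal n \<delta> f +>\<^bsub>centraliser_algebra n \<delta>\<^esub> x"
  shows "z \<in> carrier (centraliser_algebra n \<delta>)" "num_arcs b < f \<Longrightarrow> z b = x b"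
  using assms unfolding coset_eq
  by (auto simp: centraliser_iff centraliser_ideal_iff arc_ideal_def diagram_span_def conj_invariant_def)

text \<open>A coset is determined by the coefficients at diagrams with fewer than \<open>f\<close>
  arcs. In a product these involve only factors with fewer than \<open>f\<close> arcs, where the
  flip is a conjugation.\<close>

lemma commutative_quotient:
  assumes flip: "\<And>b. b \<in> diagrams n \<Longrightarrow> num_arcs b < f \<Longrightarrow> flip_conjugate n b"
  shows "commutative (centraliser_algebra n \<delta> Quot centraliser_ideal n \<delta> f)"
proof -
  let ?C = "centraliser_algebra n \<delta>" and ?I = "centraliser_ideal n \<delta> f"
  have comm: "?I +>\<^bsub>?C\<^esub> (x \<otimes>\<^bsub>brauer n \<delta>\<^esub> y) = ?I +>\<^bsub>?C\<^esub> (y \<otimes>\<^bsub>brauer n \<delta>\<^esub> x)"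
    if x: "x \<in> carrier ?C" and y: "y \<in> carrier ?C" for x y
  proof (rule coset_eqI)
    fix d assume d: "d \<in> diagrams n" "num_arcs d < f"
    show "(x \<otimes>\<^bsub>brauer n \<delta>\<^esub> y) d = (y \<otimes>\<^bsub>brauer n \<delta>\<^esub> x) d"
    proof (rule mult_commute_at[OF d(1)])
      show "(x \<otimes>\<^bsub>brauer n \<delta>\<^esub> y) (relabel swap_row d) = (x \<otimes>\<^bsub>brauer n \<delta>\<^esub> y) d"
        using flip_conjugateD[OF flip[OF d]] centraliser_mult_closed[OF x y] d
        by (simp add: centraliser_iff)
      show "x (relabel swap_row b) = x b \<and> y (relabel swap_row b) = y b"
        if "b \<in> diagrams n" "num_arcs b \<le> num_arcs d" for b
        using flip_conjugateD[OF flip] that d x y by (auto simp: centraliser_iff)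
    qed
  qed (use centraliser_mult_closed x y in auto)
  have "(\<Union>x\<in>X. \<Union>y\<in>Y. ?I +>\<^bsub>?C\<^esub> (x \<otimes>\<^bsub>brauer n \<delta>\<^esub> y)) =
      (\<Union>y\<in>Y. \<Union>x\<in>X. ?I +>\<^bsub>?C\<^esub> (y \<otimes>\<^bsub>brauer n \<delta>\<^esub> x))"
    if "X \<subseteq> carrier ?C" "Y \<subseteq> carrier ?C" for X Y
  proof -
    have "(\<Union>x\<in>X. \<Union>y\<in>Y. ?I +>\<^bsub>?C\<^esub> (x \<otimes>\<^bsub>brauer n \<delta>\<^esub> y)) =
        (\<Union>x\<in>X. \<Union>y\<in>Y. ?I +>\<^bsub>?C\<^esub> (y \<otimes>\<^bsub>brauer n \<delta>\<^esub> x))"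
      by (intro SUP_cong refl comm subsetD[OF that(1)] subsetD[OF that(2)])
    also have "\<dots> = (\<Union>y\<in>Y. \<Union>x\<in>X. ?I +>\<^bsub>?C\<^esub> (y \<otimes>\<^bsub>brauer n \<delta>\<^esub> x))"
      by (rule SUP_commute)
    finally show ?thesis .
  qed
  moreover have "X \<subseteq> carrier ?C" if "X \<in> carrier (?C Quot ?I)" for X
    using that coset_memD(1) by (auto simp: quotient_simps)
  ultimately show ?thesis by (auto simp: commutative_def quotient_simps(1))
qed

text \<open>Coefficients at diagrams with fewer than \<open>f\<close> arcs are constant on cosets,
  and so are those of products, so a discrepancy at \<open>d\<close> survives in the
  quotient.\<close>

lemma not_commutative_quotient:
  assumes x: "x \<in> carrier (centraliser_algebra n \<delta>)" and y: "y \<in> carrier (centraliser_algebra n \<delta>)"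
    and d: "d \<in> diagrams n" "num_arcs d < f"
    and neq: "(x \<otimes>\<^bsub>brauer n \<delta>\<^esub> y) d \<noteq> (y \<otimes>\<^bsub>brauer n \<delta>\<^esub> x) d"
  shows "\<not> commutative (centraliser_algebra n \<delta> Quot centraliser_ideal n \<delta> f)"
proof
  let ?C = "centraliser_algebra n \<delta>" and ?I = "centraliser_ideal n \<delta> f"
  assume "commutative (?C Quot ?I)"
  then have eq: "(?I +>\<^bsub>?C\<^esub> x) \<otimes>\<^bsub>?C Quot ?I\<^esub> (?I +>\<^bsub>?C\<^esub> y) = (?I +>\<^bsub>?C\<^esub> y) \<otimes>\<^bsub>?C Quot ?I\<^esub> (?I +>\<^bsub>?C\<^esub> x)"
    unfolding commutative_def using x y by (auto simp: quotient_simps(2))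
  have "(\<lambda>b. 0) \<in> ?I"
    by (simp add: centraliser_ideal_iff arc_ideal_def diagram_span_def conj_invariant_def)
  then have self: "z \<in> ?I +>\<^bsub>?C\<^esub> z" for z
    unfolding coset_eq by (intro CollectI exI[of _ "\<lambda>b. 0"]) simp
  have "x \<otimes>\<^bsub>brauer n \<delta>\<^esub> y \<in> (?I +>\<^bsub>?C\<^esub> x) \<otimes>\<^bsub>?C Quot ?I\<^esub> (?I +>\<^bsub>?C\<^esub> y)"
    unfolding quotient_simps(1) using self by blast
  \<comment> \<open>Membership in the union yields some representatives only, which need not be
    \<open>y\<close> and \<open>x\<close>; below they are compared with \<open>y\<close> and
    \<open>x\<close> on diagrams with fewer than \<open>f\<close> arcs.\<close>
  then obtain y' x' where y': "y' \<in> ?I +>\<^bsub>?C\<^esub> y" and x': "x' \<in> ?I +>\<^bsub>?C\<^esub> x"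
    and mem: "x \<otimes>\<^bsub>brauer n \<delta>\<^esub> y \<in> ?I +>\<^bsub>?C\<^esub> (y' \<otimes>\<^bsub>brauer n \<delta>\<^esub> x')"
    unfolding eq unfolding quotient_simps(1) by blast
  have "(x \<otimes>\<^bsub>brauer n \<delta>\<^esub> y) d = (y' \<otimes>\<^bsub>brauer n \<delta>\<^esub> x') d"
    using coset_memD(2)[OF _ mem d(2)] centraliser_mult_closed coset_memD(1) x y x' y' by blast
  also have "\<dots> = (y \<otimes>\<^bsub>brauer n \<delta>\<^esub> x) d"
    unfolding brauer_mult
  proof (intro sum.cong refl if_cong)
    fix b1 b2 assume b: "b1 \<in> diagrams n" "b2 \<in> diagrams n" "compose_diagrams n b1 b2 = d"
    then have "num_arcs b1 < f" "num_arcs b2 < f"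
      using num_arcs_compose_left[OF b(1,2)] num_arcs_compose_right[OF b(1,2)] d(2) by auto
    then show "y' b1 * x' b2 * \<delta> ^ num_loops n b1 b2 = y b1 * x b2 * \<delta> ^ num_loops n b1 b2"
      using coset_memD(2)[OF y y'] coset_memD(2)[OF x x'] by simp
  qed
  finally show False using neq by simp
qed

section \<open>Diagrams conjugate to their flip\<close>

text \<open>In the application \<open>g\<close> is the partner map of a diagram and \<open>h\<close>
  is \<open>swap_row\<close>. The orbits of the dihedral group they generate are the cycles that
  arise by identifying the nodes of each column.\<close>

locale two_involutions =
  fixes g h :: "'a \<Rightarrow> 'a"
  assumes gg [simp]: "g (g x) = x" and hh [simp]: "h (h x) = x"
begin

text \<open>Integer powers of the rotation \<open>h \<circ> g\<close>, whose inverse is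
  \<open>g \<circ> h\<close>.\<close>

definition rot :: "int \<Rightarrow> 'a \<Rightarrow> 'a" where
  "rot k = (if k \<ge> 0 then (h \<circ> g) ^^ nat k else (g \<circ> h) ^^ nat (- k))"

lemma rot_0 [simp]: "rot 0 x = x"
  by (simp add: rot_def)

lemma rot_plus_1: "rot (k + 1) x = h (g (rot k x))"
proof (cases "k \<ge> 0")
  case True
  then have "nat (k + 1) = Suc (nat k)" by simp
  then show ?thesis using True by (simp add: rot_def)
next
  case False
  then have "nat (- k) = Suc (nat (- (k + 1)))" by simp
  then show ?thesis using False by (cases "k = -1") (simp_all add: rot_def)
qed

lemma rot_minus_1: "rot (k - 1) x = g (h (rot k x))"
  using rot_plus_1[of "k - 1" x] by simp

lemma rot_1: "rot 1 x = h (g x)"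
  using rot_plus_1[of 0 x] by simp

lemma rot_add: "rot (j + k) x = rot j (rot k x)"
proof (induction j rule: int_induct[where k = 0])
  case (step1 i)
  have "rot (i + 1 + k) x = rot ((i + k) + 1) x" by (simp add: algebra_simps)
  then show ?case using step1 by (simp only: rot_plus_1)
next
  case (step2 i)
  have "rot (i - 1 + k) x = rot ((i + k) - 1) x" by (simp add: algebra_simps)
  then show ?case using step2 by (simp only: rot_minus_1)
qed simp

text \<open>The dihedral relation: conjugating by \<open>h\<close> inverts the rotation. It explains
  why \<open>orb\<close> needs only the elements \<open>rot k\<close> and
  \<open>h \<circ> rot k\<close>.\<close>

lemma rot_flip: "h (rot k x) = rot (- k) (h x)"
proof (induction k rule: int_induct[where k = 0])
  case (step1 i)
  have "rot (- i - 1) (h x) = g (h (rot (- i) (h x)))" by (rule rot_minus_1)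
  also have "\<dots> = g (rot i x)" by (simp only: step1(2)[symmetric] hh)
  finally show ?case by (simp add: rot_plus_1)
next
  case (step2 i)
  have "rot (- i + 1) (h x) = h (g (rot (- i) (h x)))" by (rule rot_plus_1)
  also have "\<dots> = h (g (h (rot i x)))" by (simp only: step2(2)[symmetric])
  finally show ?case by (simp add: rot_minus_1)
qed simp

definition orb :: "'a \<Rightarrow> 'a set" where
  "orb x = range (\<lambda>k. rot k x) \<union> range (\<lambda>k. h (rot k x))"

lemma orb_rot: "orb (rot k x) = orb x"
proof -
  have "range (\<lambda>j. f (rot j (rot k x))) = range (\<lambda>j. f (rot j x))" for f :: "'a \<Rightarrow> 'b"
  proof
    show "range (\<lambda>j. f (rot j (rot k x))) \<subseteq> range (\<lambda>j. f (rot j x))"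
      by (auto simp flip: rot_add)
    show "range (\<lambda>j. f (rot j x)) \<subseteq> range (\<lambda>j. f (rot j (rot k x)))"
    proof
      fix y assume "y \<in> range (\<lambda>j. f (rot j x))"
      then obtain j where "y = f (rot j x)" by auto
      then have "y = f (rot (j - k) (rot k x))" by (simp flip: rot_add)
      then show "y \<in> range (\<lambda>j. f (rot j (rot k x)))" by auto
    qed
  qed
  from this[of "\<lambda>x. x"] this[of h] show ?thesis by (simp add: orb_def)
qed

lemma orb_flip: "orb (h x) = orb x"
proof -
  have neg: "range (\<lambda>k::int. f (- k)) = range f" for f :: "int \<Rightarrow> 'a"
  proof (intro equalityI subsetI)
    fix y assume "y \<in> range f"
    then obtain k where "y = f (- (- k))" by auto
    then show "y \<in> range (\<lambda>k. f (- k))" by blast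
  qed auto
  have "range (\<lambda>k. rot k (h x)) = range (\<lambda>k. h (rot k x))"
    unfolding rot_flip neg[of "\<lambda>k. rot k (h x)"] ..
  moreover have "range (\<lambda>k. h (rot k (h x))) = range (\<lambda>k. rot k x)"
    unfolding rot_flip hh neg[of "\<lambda>k. rot k x"] ..
  ultimately show ?thesis by (simp add: orb_def Un_commute)
qed

lemma mem_orb [intro, simp]: "x \<in> orb x" "rot k x \<in> orb x" "h (rot k x) \<in> orb x"
  using rot_0[of x] unfolding orb_def by (blast intro: rangeI | metis UnI1 rangeI)+

lemma orb_eq: "y \<in> orb x \<Longrightarrow> orb y = orb x"
  by (auto simp: orb_def[of x] orb_rot orb_flip)

lemma orb_subset:
  assumes "\<And>x. x \<in> X \<Longrightarrow> g x \<in> X" "\<And>x. x \<in> X \<Longrightarrow> h x \<in> X" "x \<in> X"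
  shows "orb x \<subseteq> X"
proof -
  have "rot k x \<in> X" for k
    by (induction k rule: int_induct[where k = 0]) (use assms rot_plus_1 rot_minus_1 in auto)
  then show ?thesis using assms(2) by (auto simp: orb_def)
qed

text \<open>A conjugate of an involution without fixed points has no fixed points.\<close>

lemma rot_neq_flip:
  assumes fixfree: "\<And>y. y \<in> orb x \<Longrightarrow> g y \<noteq> y" "\<And>y. y \<in> orb x \<Longrightarrow> h y \<noteq> y"
  shows "rot j x \<noteq> h (rot k x)"
proof
  assume eq: "rot j x = h (rot k x)"
  define m where "m = j - k"
  have cancel: "u = v" if "rot i u = rot i v" for i u v
    using arg_cong[OF that, of "rot (- i)"] by (simp flip: rot_add)
  show False
  proof (cases "even m")
    case True
    then obtain i where i: "m = i + i" by (auto elim: evenE)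
    \<comment> \<open>The midpoint between \<open>rot k x\<close> and \<open>rot j x\<close>; the
      reflection that relates these two makes it a fixed point of \<open>h\<close>.\<close>
    define w where "w = rot (i + k) x"
    have "i + (i + k) = j" using i by (simp add: m_def)
    then have "rot i w = rot j x" by (simp only: w_def rot_add[symmetric])
    also have "\<dots> = h (rot (- i) w)" by (simp add: eq w_def flip: rot_add)
    also have "\<dots> = rot i (h w)" by (simp add: rot_flip)
    finally show False using cancel fixfree(2)[of w] by (metis w_def mem_orb(2))
  next
    case False
    then obtain i where i: "m = i + i + 1" by (auto elim: oddE)
    \<comment> \<open>An odd distance has no midpoint; here the reflection is a conjugate of
      \<open>g\<close>, and \<open>h w\<close> becomes its fixed point.\<close>
    define w where "w = rot (i + 1 + k) x"
    have "i + (i + 1 + k) = j" using i by (simp add: m_def)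
    then have "rot i w = rot j x" by (simp only: w_def rot_add[symmetric])
    also have "\<dots> = h (rot (- (i + 1)) w)" by (simp add: eq w_def flip: rot_add)
    also have "\<dots> = rot (i + 1) (h w)" by (simp only: rot_flip minus_minus)
    also have "\<dots> = rot i (h (g (h w)))" by (simp add: rot_add rot_1)
    finally have "h w = g (h w)" using cancel hh by metis
    then show False using fixfree(1)[of "h w"] by (metis w_def mem_orb(3))
  qed
qed

text \<open>The sequence of rows along the rotations of \<open>v\<close> is a palindrome with centre
  \<open>c / 2\<close>.\<close>

definition reflects :: "('a \<Rightarrow> bool) \<Rightarrow> int \<Rightarrow> 'a \<Rightarrow> bool" where
  "reflects row c v \<longleftrightarrow> (\<forall>k. row (rot (c - k) v) = row (rot k v))"

text \<open>On each orbit \<open>r\<close> sends \<open>rot k v\<close> to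
  \<open>rot (c - k) v\<close> and is extended by commuting with \<open>h\<close>. The two
  prescriptions cannot clash, by \<open>rot_neq_flip\<close>. Since \<open>r\<close> turns
  \<open>g\<close> into its conjugate by \<open>h\<close>, it carries a diagram to its flip; since
  it respects rows and commutes with \<open>h\<close>, it comes from a permutation of the
  columns.\<close>

lemma reflection_exists:
  assumes closed: "\<And>x. x \<in> X \<Longrightarrow> g x \<in> X" "\<And>x. x \<in> X \<Longrightarrow> h x \<in> X"
    and fixfree: "\<And>x. x \<in> X \<Longrightarrow> g x \<noteq> x" "\<And>x. x \<in> X \<Longrightarrow> h x \<noteq> x"
    and row: "\<And>x. row (h x) \<longleftrightarrow> \<not> row x"
    and centre: "\<And>x. x \<in> X \<Longrightarrow> \<exists>c v. v \<in> orb x \<and> reflects row c v"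
  shows "\<exists>r. \<forall>x\<in>X. r x \<in> X \<and> r (r x) = x \<and> r (h x) = h (r x) \<and> r (g x) = h (g (h (r x))) \<and>
    (row (r x) \<longleftrightarrow> row x)"
proof -
  \<comment> \<open>The choice depends on the orbit as a set, so that all its points use the same
    centre.\<close>
  define rep where "rep O' = (SOME p. fst p \<in> O' \<and> reflects row (snd p) (fst p))" for O'
  have rep: "fst (rep (orb x)) \<in> orb x" "reflects row (snd (rep (orb x))) (fst (rep (orb x)))"
    if x: "x \<in> X" for x
  proof -
    have "\<exists>p. fst p \<in> orb x \<and> reflects row (snd p) (fst p)" using centre[OF x] by auto
    from someI_ex[OF this]
    show "fst (rep (orb x)) \<in> orb x" "reflects row (snd (rep (orb x))) (fst (rep (orb x)))"
      by (simp_all add: rep_def)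
  qed
  define r where "r x = (case rep (orb x) of (v, c) \<Rightarrow>
    if \<exists>k. x = rot k v then rot (c - (SOME k. x = rot k v)) v
    else h (rot (c - (SOME k. x = h (rot k v))) v))" for x
  have r: "r (rot k v) = rot (c - k) v" "r (h (rot k v)) = h (rot (c - k) v)"
    if v: "v \<in> X" "rep (orb v) = (v, c)" for v c k
  proof -
    have orbX: "orb v \<subseteq> X" using orb_subset[of X] closed v(1) by blast
    \<comment> \<open>Exponents of the same point differ by a period, so the value of
      \<open>r\<close> is independent of the one that is chosen.\<close>
    have period: "rot (c - j) v = rot (c - k) v" if "rot k v = rot j v" for j
    proof -
      have "rot (c - j) v = rot (c - k - j) (rot k v)" by (simp flip: rot_add)
      also have "\<dots> = rot (c - k) v" unfolding that by (simp flip: rot_add)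
      finally show ?thesis .
    qed
    have neq: "h (rot k v) \<noteq> rot j v" for j
      using rot_neq_flip[of v j k] fixfree orbX by (metis subsetD)
    define i where "i = (SOME j. rot k v = rot j v)"
    have "rot k v = rot i v" unfolding i_def by (rule someI[of _ k]) (rule refl)
    then have "rot (c - i) v = rot (c - k) v" by (rule period)
    moreover have "r (rot k v) = rot (c - i) v"
    proof -
      have "\<exists>j. rot k v = rot j v" by blast
      then show ?thesis unfolding r_def orb_rot v(2) by (simp add: i_def)
    qed
    ultimately show "r (rot k v) = rot (c - k) v" by simp
    define j where "j = (SOME j. h (rot k v) = h (rot j v))"
    have "h (rot k v) = h (rot j v)" unfolding j_def by (rule someI[of _ k]) (rule refl)
    then have "rot k v = rot j v" by (metis hh)
    then have "rot (c - j) v = rot (c - k) v" by (rule period)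
    moreover have "r (h (rot k v)) = h (rot (c - j) v)"
      unfolding r_def orb_flip orb_rot v(2) using neq by (simp add: j_def)
    ultimately show "r (h (rot k v)) = h (rot (c - k) v)" by simp
  qed
  have "r x \<in> X \<and> r (r x) = x \<and> r (h x) = h (r x) \<and> r (g x) = h (g (h (r x))) \<and> (row (r x) \<longleftrightarrow> row x)"
    if x: "x \<in> X" for x
  proof -
    obtain v c where vc: "rep (orb x) = (v, c)" by fastforce
    have v: "v \<in> orb x" and refl: "reflects row c v" using rep[OF x] vc by auto
    then have orb: "orb v = orb x" and vX: "v \<in> X" using orb_eq orb_subset[of X] closed x by blast+
    have repv: "rep (orb v) = (v, c)" using orb vc by simp
    note r = r[OF vX repv]
    have rows: "row (rot (c - k) v) = row (rot k v)" for k using refl by (simp add: reflects_def)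
    have inX: "rot k v \<in> X" "h (rot k v) \<in> X" for k
      using orb_subset[of X v] closed vX mem_orb(2,3)[of _ v] by blast+
    have g_rot: "g (rot k v) = h (rot (k + 1) v)" for k by (simp add: rot_plus_1)
    have gh_rot: "g (h (rot k v)) = rot (k - 1) v" for k by (simp add: rot_minus_1)
    obtain k where "x = rot k v \<or> x = h (rot k v)"
      using orb mem_orb(1)[of x] by (auto simp: orb_def)
    then show ?thesis
    proof
      assume k: "x = rot k v"
      have "r (g x) = h (rot (c - (k + 1)) v)" unfolding k g_rot r ..
      also have "\<dots> = h (g (h (r x)))" unfolding k r gh_rot by (simp add: algebra_simps)
      finally show ?thesis unfolding k r by (simp add: r rows inX)
    next
      assume k: "x = h (rot k v)"
      have "r (g x) = rot (c - (k - 1)) v" unfolding k gh_rot r ..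
      also have "\<dots> = h (g (h (r x)))" unfolding k r hh g_rot by (simp add: algebra_simps)
      finally show ?thesis unfolding k r by (simp add: r rows row inX)
    qed
  qed
  then show ?thesis by blast
qed

text \<open>The rows along an orbit are determined by which nodes lie on arcs, so a reflection of the
  orbit need only respect the latter.\<close>

lemma reflectsI:
  assumes row: "\<And>x. row (h x) \<longleftrightarrow> \<not> row x"
    and arc: "\<And>k. (row (g (rot (c - 1 - k) v)) = row (rot (c - 1 - k) v)) = (row (g (rot k v)) = row (rot k v))"
    and c: "row (rot c v) = row v"
  shows "reflects row c v"
proof -
  \<comment> \<open>Since \<open>h\<close> changes the row, an arc at position \<open>k\<close>
    leads to the other row and a through line to the same row. The edge at \<open>k\<close> lies
    between the points \<open>k\<close> and \<open>k + 1\<close>, so the reflection sends it to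
    position \<open>c - 1 - k\<close>.\<close>
  have step: "row (rot (k + 1) v) \<longleftrightarrow> (row (rot k v) \<noteq> (row (g (rot k v)) = row (rot k v)))" for k
    unfolding rot_plus_1 row by auto
  have "row (rot (c - k) v) = row (rot k v)" for k
  proof (induction k rule: int_induct[where k = 0])
    case base
    show ?case using c by simp
  next
    case (step1 k)
    have "row (rot (c - 1 - k + 1) v) = row (rot k v)" using step1 by (simp add: algebra_simps)
    then show ?case using step[of "c - 1 - k"] step[of k] arc[of k] by (auto simp: algebra_simps)
  next
    case (step2 k)
    have "c - k + 1 = c - (k - 1)" "c - 1 - (c - k) = k - 1" by simp_all
    then have "row (rot (c - (k - 1)) v) \<longleftrightarrow>
        (row (rot (c - k) v) \<noteq> (row (g (rot (c - k) v)) = row (rot (c - k) v)))"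
      and "(row (g (rot (k - 1) v)) = row (rot (k - 1) v)) =
        (row (g (rot (c - k) v)) = row (rot (c - k) v))"
      using step[of "c - k"] arc[of "c - k"] by (simp_all only:)
    moreover have "row (rot k v) \<longleftrightarrow> (row (rot (k - 1) v) \<noteq> (row (g (rot (k - 1) v)) = row (rot (k - 1) v)))"
      using step[of "k - 1"] by simp
    ultimately show ?case using step2(2) by blast
  qed
  then show ?thesis by (simp add: reflects_def)
qed

lemma rot_periodic:
  assumes "finite (orb x)"
  obtains m :: nat where "m \<ge> 1" "rot (int m) x = x"
proof -
  have "\<not> inj (\<lambda>i::nat. rot (int i) x)"
  proof
    assume "inj (\<lambda>i::nat. rot (int i) x)"
    moreover have "range (\<lambda>i::nat. rot (int i) x) \<subseteq> orb x" by auto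
    ultimately show False using assms finite_subset finite_imageD infinite_UNIV_nat by blast
  qed
  then obtain a b :: nat where "a \<noteq> b" "rot (int a) x = rot (int b) x" by (auto simp: inj_def)
  then obtain i j :: nat where ij: "i < j" "rot (int i) x = rot (int j) x"
    by (metis nat_neq_iff)
  have "rot (int (j - i)) x = rot (- int i) (rot (int j) x)"
    using ij(1) by (simp add: of_nat_diff algebra_simps flip: rot_add)
  also have "\<dots> = x" unfolding ij(2)[symmetric] by (simp flip: rot_add)
  finally show ?thesis using that[of "j - i"] ij(1) by simp
qed

text \<open>The row changes exactly at arcs. After an arc at position 0, the next one, at
  \<open>m\<close>, lies in the other row; together they exhaust the arcs met by rotating
  \<open>v\<close>, and a reflection can exchange them. Without arcs the row is constant.\<close>

lemma reflects_few_arcs: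
  assumes fin: "finite (orb x)"
    and fixfree: "\<And>y. y \<in> orb x \<Longrightarrow> g y \<noteq> y" "\<And>y. y \<in> orb x \<Longrightarrow> h y \<noteq> y"
    and row: "\<And>x. row (h x) \<longleftrightarrow> \<not> row x"
    and arcs: "\<And>u w. u \<in> orb x \<Longrightarrow> w \<in> orb x \<Longrightarrow> row (g u) = row u \<Longrightarrow> row (g w) = row w \<Longrightarrow>
      row u = row w \<Longrightarrow> w = u \<or> w = g u"
  shows "\<exists>c v. v \<in> orb x \<and> reflects row c v"
proof (cases "\<exists>k. row (g (rot k x)) = row (rot k x)")
  case False
  then have "reflects row 0 x" by (intro reflectsI row) auto
  then show ?thesis by blast
next
  case True
  then obtain k0 where k0: "row (g (rot k0 x)) = row (rot k0 x)" by blast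
  define v where "v = rot k0 x"
  define arc where "arc k \<longleftrightarrow> row (g (rot k v)) = row (rot k v)" for k
  have orb: "orb v = orb x" unfolding v_def by (rule orb_rot)
  have arc0: "arc 0" using k0 by (simp add: arc_def v_def)
  obtain N :: nat where N: "N \<ge> 1" "rot (int N) v = v"
    using rot_periodic[of v] fin orb by auto
  have step: "row (rot (k + 1) v) \<longleftrightarrow> (row (rot k v) \<noteq> arc k)" for k
    unfolding rot_plus_1 row arc_def by auto
  \<comment> \<open>The next arc after the one at position 0; it exists because the period
    \<open>N\<close> brings the latter back.\<close>
  define m where "m = (LEAST m::nat. m \<ge> 1 \<and> arc (int m))"
  have "N \<ge> 1 \<and> arc (int N)" using N arc0 by (simp add: arc_def)
  then have m: "m \<ge> 1" "arc (int m)"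
    using LeastI[of "\<lambda>m::nat. m \<ge> 1 \<and> arc (int m)" N] by (auto simp: m_def)
  have not_arc: "\<not> arc (int j)" if "1 \<le> j" "j < m" for j
    using not_less_Least[of j "\<lambda>m::nat. m \<ge> 1 \<and> arc (int m)"] that by (auto simp: m_def)
  have rows: "j < m \<Longrightarrow> row (rot (int (Suc j)) v) \<noteq> row v" for j
  proof (induction j)
    case 0
    then show ?case using step[of 0] arc0 by simp
  next
    case (Suc j)
    have "\<not> arc (int (Suc j))" by (rule not_arc) (use Suc.prems in simp_all)
    then show ?case using step[of "int (Suc j)"] Suc by (simp add: add.commute)
  qed
  have row_m: "row (rot (int m) v) \<noteq> row v" using rows[of "m - 1"] m(1) by simp
  have neq: "rot k v \<noteq> g (rot j v)" for j k
  proof -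
    have "g (rot j v) = h (rot (j + 1) v)" by (simp add: rot_plus_1)
    then show ?thesis using rot_neq_flip[of v k "j + 1"] fixfree orb by metis
  qed
  have v_orb: "rot k v \<in> orb x" for k using orb mem_orb(2) by metis
  have arc_iff: "arc k \<longleftrightarrow> rot k v = v \<or> rot k v = rot (int m) v" for k
  proof
    assume k: "arc k"
    show "rot k v = v \<or> rot k v = rot (int m) v"
    proof (cases "row (rot k v) = row v")
      case True
      then show ?thesis
        using arcs[OF v_orb[of 0] v_orb[of k]] k arc0 neq[of k 0] by (auto simp: arc_def)
    next
      case False
      then show ?thesis
        using arcs[OF v_orb[of "int m"] v_orb[of k]] k m(2) row_m neq[of k "int m"]
        by (auto simp: arc_def)
    qed
  qed (use arc0 m(2) in \<open>auto simp: arc_def\<close>)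
  have cancel: "rot (i + j) v = rot (i + k) v \<longleftrightarrow> rot j v = rot k v" for i j k
  proof
    assume "rot (i + j) v = rot (i + k) v"
    from arg_cong[OF this, of "rot (- i)"] show "rot j v = rot k v" by (simp flip: rot_add)
  qed (simp add: rot_add)
  have "arc (int m + 1 - 1 - k) = arc k" for k
  proof -
    have "rot (int m - k) v = rot 0 v \<longleftrightarrow> rot (int m) v = rot k v"
      using cancel[of k "int m - k" 0] by simp
    moreover have "rot (int m - k) v = rot (int m) v \<longleftrightarrow> rot 0 v = rot k v"
      using cancel[of "int m - k" 0 k] by simp
    ultimately show ?thesis by (auto simp: arc_iff eq_commute)
  qed
  \<comment> \<open>Exchanging the arcs at positions 0 and \<open>m\<close> requires
    \<open>c - 1 = m\<close>.\<close>
  then have "reflects row (int m + 1) v"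
    by (intro reflectsI row) (use step[of "int m"] m(2) row_m in \<open>auto simp: arc_def\<close>)
  then show ?thesis using v_orb[of 0] by auto
qed

text \<open>If all edges are arcs, the rows alternate and \<open>c = 0\<close> keeps parity.
  Otherwise the reflection is centred at the through line, the only place where the alternation
  fails.\<close>

lemma reflects_few_through:
  assumes fixfree: "\<And>y. y \<in> orb x \<Longrightarrow> g y \<noteq> y" "\<And>y. y \<in> orb x \<Longrightarrow> h y \<noteq> y"
    and row: "\<And>x. row (h x) \<longleftrightarrow> \<not> row x"
    and through: "\<And>u w. u \<in> orb x \<Longrightarrow> w \<in> orb x \<Longrightarrow> row (g u) \<noteq> row u \<Longrightarrow> row (g w) \<noteq> row w \<Longrightarrow>
      w = u \<or> w = g u"
  shows "\<exists>c v. v \<in> orb x \<and> reflects row c v"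
proof (cases "\<exists>k. row (g (rot k x)) \<noteq> row (rot k x)")
  case False
  then have "reflects row 0 x" by (intro reflectsI row) auto
  then show ?thesis by blast
next
  case True
  then obtain k0 where k0: "row (g (rot k0 x)) \<noteq> row (rot k0 x)" by blast
  define v where "v = rot k0 x"
  have orb: "orb v = orb x" unfolding v_def by (rule orb_rot)
  have v_orb: "rot k v \<in> orb x" for k using orb mem_orb(2) by metis
  have neq: "rot k v \<noteq> g v" for k
  proof -
    have "g v = h (rot 1 v)" by (simp add: rot_1)
    then show ?thesis using rot_neq_flip[of v k 1] fixfree orb by metis
  qed
  have through_iff: "row (g (rot k v)) \<noteq> row (rot k v) \<longleftrightarrow> rot k v = v" for k
    using through[of v "rot k v"] v_orb[of 0] v_orb[of k] k0 neq[of k] by (auto simp: v_def)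
  have "rot (- k) v = v \<longleftrightarrow> rot k v = v" for k
  proof
    assume "rot (- k) v = v"
    from arg_cong[OF this, of "rot k"] show "rot k v = v" by (simp flip: rot_add)
  next
    assume "rot k v = v"
    from arg_cong[OF this, of "rot (- k)"] show "rot (- k) v = v" by (simp flip: rot_add)
  qed
  \<comment> \<open>The edge at position 0 is to be its own image, so
    \<open>c - 1 = 0\<close>.\<close>
  then have "reflects row 1 v"
    using through_iff k0 by (intro reflectsI row) (auto simp: rot_1 row v_def[symmetric])
  then show ?thesis using v_orb[of 0] by auto
qed

end

lemma flip_conjugateI:
  assumes b: "b \<in> diagrams n" and "num_arcs b \<le> 1 \<or> num_arcs b = n div 2"
  shows "flip_conjugate n b"
proof -
  \<comment> \<open>\<open>partner\<close> is unspecified off \<open>nodes n\<close>; the identity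
    there gives an involution of the whole type.\<close>
  define g where "g x = (if x \<in> nodes n then partner b x else x)" for x
  have g: "g x = partner b x" "g x \<in> nodes n" "g x \<noteq> x" if "x \<in> nodes n" for x
    using that partner_in_nodes[OF b] partner_neq[OF b] by (auto simp: g_def)
  interpret two_involutions g swap_row
    by standard (auto simp: g_def partner_in_nodes[OF b] partner_partner[OF b])
  let ?row = "\<lambda>x. x \<in> range Upper"
  have row: "?row (swap_row x) \<longleftrightarrow> \<not> ?row x" for x by (cases x) auto
  have fixfree: "swap_row x \<noteq> x" for x by (cases x) auto
  have orb_nodes: "orb x \<subseteq> nodes n" if "x \<in> nodes n" for x
    using that g by (intro orb_subset) auto
  have centre: "\<exists>c v. v \<in> orb x \<and> reflects ?row c v" if x: "x \<in> nodes n" for x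
    using assms(2)
  proof
    assume one: "num_arcs b \<le> 1"
    show ?thesis
    proof (rule reflects_few_arcs[where row = ?row])
      show "swap_row y \<noteq> y" "?row (swap_row y) \<longleftrightarrow> \<not> ?row y" for y by (fact fixfree row)+
      show "finite (orb x)" using finite_subset[OF orb_nodes[OF x]] by simp
      show "g y \<noteq> y" if "y \<in> orb x" for y using that g orb_nodes[OF x] by blast
      fix u w assume "u \<in> orb x" "w \<in> orb x"
        and arc: "?row (g u) = ?row u" "?row (g w) = ?row w" "?row u = ?row w"
      then have uw: "u \<in> nodes n" "w \<in> nodes n" using orb_nodes[OF x] by auto
      define R where "R = (if ?row u then Upper else Lower)"
      have R: "y \<in> range R" if "?row y = ?row u" for y using that by (cases y) (auto simp: R_def)
      have "inj R" by (auto simp: R_def inj_def)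
      have mem: "y \<in> R ` arc_nodes R n b" if "y \<in> nodes n" "?row y = ?row u" "?row (g y) = ?row y" for y
      proof -
        have "y \<in> R ` {1..n}" using R[of y] that by (auto simp: R_def nodes_def)
        then show ?thesis using R[of "g y"] that g(1)[of y] by (auto simp: arc_nodes_def)
      qed
      have gu: "g u \<in> nodes n" "g u \<noteq> u" using g uw by auto
      show "w = u \<or> w = g u"
      proof (rule ccontr)
        assume "\<not> ?thesis"
        then have "u \<noteq> g u" "u \<noteq> w" "g u \<noteq> w" using gu by auto
        then have "card {u, g u, w} = 3" by simp
        moreover have "{u, g u, w} \<subseteq> R ` arc_nodes R n b"
          using mem[of u] mem[of "g u"] mem[of w] gu uw arc by simp
        ultimately have "3 \<le> card (R ` arc_nodes R n b)" by (metis card_mono finite_arc_nodes finite_imageI)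
        also have "\<dots> \<le> card (arc_nodes R n b)" by (intro card_image_le) simp
        also have "\<dots> \<le> 2" using card_arc_nodes[OF b] one by (simp add: R_def)
        finally show False by simp
      qed
    qed
  next
    assume max: "num_arcs b = n div 2"
    \<comment> \<open>Every through line is represented by its upper end, and there are
      \<open>n mod 2\<close> of them.\<close>
    let ?T = "Upper ` ({1..n} - arc_nodes Upper n b)"
    have "card ?T = n - 2 * (n div 2)"
    proof -
      have "card ?T = card ({1..n} - arc_nodes Upper n b)" by (simp add: card_image inj_on_def)
      also have "arc_nodes Upper n b \<subseteq> {1..n}" by (auto simp: arc_nodes_def)
      then have "card ({1..n} - arc_nodes Upper n b) = n - card (arc_nodes Upper n b)"
        by (simp add: card_Diff_subset)
      finally show ?thesis using card_arc_nodes(1)[OF b] max by simp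
    qed
    then have T: "card ?T \<le> 1" by presburger
    show ?thesis
    proof (rule reflects_few_through[where row = ?row])
      show "swap_row y \<noteq> y" "?row (swap_row y) \<longleftrightarrow> \<not> ?row y" for y by (fact fixfree row)+
      show "g y \<noteq> y" if "y \<in> orb x" for y using that g orb_nodes[OF x] by blast
      fix u w assume "u \<in> orb x" "w \<in> orb x"
        and through: "?row (g u) \<noteq> ?row u" "?row (g w) \<noteq> ?row w"
      then have uw: "u \<in> nodes n" "w \<in> nodes n" using orb_nodes[OF x] by auto
      have mem: "y \<in> ?T \<or> g y \<in> ?T" if y: "y \<in> nodes n" "?row (g y) \<noteq> ?row y" for y
      proof (cases "?row y")
        case True
        then obtain i where "y = Upper i" by auto
        then show ?thesis using that g(1)[OF that(1)] True by (auto simp: arc_nodes_def)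
      next
        case False
        then obtain i where i: "g y = Upper i" using y(2) by auto
        moreover have "partner b (Upper i) = y" using i g(1)[OF that(1)] partner_partner[OF b that(1)] by simp
        moreover have "Upper i \<in> nodes n" using i g(2)[OF that(1)] by simp
        ultimately show ?thesis using False by (auto simp: arc_nodes_def)
      qed
      have unique: "y = z" if "y \<in> ?T" "z \<in> ?T" for y z
        using T that card_le_Suc0_iff_eq[of ?T] by auto
      show "w = u \<or> w = g u"
        using mem[OF uw(1) through(1)] mem[OF uw(2) through(2)] unique gg by metis
    qed
  qed
  have "\<exists>r. \<forall>x\<in>nodes n. r x \<in> nodes n \<and> r (r x) = x \<and> r (swap_row x) = swap_row (r x) \<and>
      r (g x) = swap_row (g (swap_row (r x))) \<and> (?row (r x) \<longleftrightarrow> ?row x)"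
  proof (rule reflection_exists)
    show "swap_row x \<noteq> x" "?row (swap_row x) \<longleftrightarrow> \<not> ?row x" for x by (fact fixfree row)+
  qed (use g(2,3) centre in simp_all)
  then obtain r where r: "\<And>x. x \<in> nodes n \<Longrightarrow> r x \<in> nodes n \<and> r (r x) = x \<and>
      r (swap_row x) = swap_row (r x) \<and> r (g x) = swap_row (g (swap_row (r x))) \<and> (?row (r x) \<longleftrightarrow> ?row x)"
    by blast
  \<comment> \<open>The permutation is read off from the lower row, which \<open>r\<close>
    preserves; as \<open>r\<close> commutes with \<open>swap_row\<close>, it acts alike on the upper
    row.\<close>
  have "\<forall>i. \<exists>j. i \<in> {1..n} \<longrightarrow> r (Lower i) = Lower j"
  proof
    fix i show "\<exists>j. i \<in> {1..n} \<longrightarrow> r (Lower i) = Lower j"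
      using r[of "Lower i"] by (cases "r (Lower i)") auto
  qed
  then obtain p0 where p0: "\<And>i. i \<in> {1..n} \<Longrightarrow> r (Lower i) = Lower (p0 i)" by metis
  define p where "p i = (if i \<in> {1..n} then p0 i else i)" for i
  have p_in: "p i \<in> {1..n}" and p_p: "p (p i) = i" if "i \<in> {1..n}" for i
  proof -
    show pi: "p i \<in> {1..n}" using r[of "Lower i"] p0[OF that] that by (auto simp: p_def)
    have "Lower (p (p i)) = r (r (Lower i))" using p0[OF that] p0[OF pi] that pi by (simp add: p_def)
    then show "p (p i) = i" using r[of "Lower i"] that by simp
  qed
  have "bij_betw p {1..n} {1..n}"
    using p_in p_p by (intro bij_betw_byWitness[where f' = p]) auto
  then have perm: "p permutes {1..n}" by (intro bij_imp_permutes) (auto simp: p_def)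
  have r_eq: "r x = node_map p p x" if x: "x \<in> nodes n" for x
  proof (cases x)
    case (Lower i)
    then show ?thesis using p0 x by (simp add: p_def)
  next
    case (Upper i)
    then show ?thesis using p0[of i] r[of "Lower i"] x by (simp add: p_def)
  qed
  have "relabel (node_map p p) b = relabel swap_row b"
  proof (rule diagram_eqI)
    show "relabel (node_map p p) b \<in> diagrams n" using node_map_in_diagrams[OF perm perm b] .
    show "relabel swap_row b \<in> diagrams n" using b by simp
    fix y assume y: "y \<in> nodes n"
    define x where "x = r y"
    have x: "x \<in> nodes n" "y = r x" using r[OF y] by (auto simp: x_def)
    have "partner (relabel (node_map p p) b) y = node_map p p (partner b x)"
      using partner_relabel[OF bij_node_map[OF perm perm] b x(1)] x r_eq by simp
    also have "\<dots> = r (g x)" using r_eq g x(1) by simp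
    also have "\<dots> = swap_row (partner b (swap_row y))" using r[OF x(1)] g(1)[of "swap_row y"] x y by simp
    finally show "{y, partner (relabel (node_map p p) b) y} \<in> relabel swap_row b"
      using relabel_edge[OF partner_edge[OF b, of "swap_row y"], of swap_row] y by simp
  qed
  then show ?thesis using perm by (auto simp: flip_conjugate_def)
qed

section \<open>Non-commuting elements\<close>

lemma partner_involution:
  assumes "\<And>x. x \<in> nodes n \<Longrightarrow> g x \<in> nodes n" "\<And>x. x \<in> nodes n \<Longrightarrow> g x \<noteq> x"
    "\<And>x. x \<in> nodes n \<Longrightarrow> g (g x) = x" "x \<in> nodes n"
  shows "partner {{x, g x} | x. x \<in> nodes n} x = g x"
  by (rule partner_eqI[OF involution_diagram[OF assms(1-3)]]) (use assms(4) in blast)+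

lemma arc_nodes_Upper_compose:
  assumes b: "b1 \<in> diagrams n" "b2 \<in> diagrams n"
  shows "arc_nodes Upper n b2 \<subseteq> arc_nodes Upper n (compose_diagrams n b1 b2)"
proof
  fix i assume "i \<in> arc_nodes Upper n b2"
  then obtain j where ij: "i \<in> {1..n}" "partner b2 (Upper i) = Upper j" by (auto simp: arc_nodes_def)
  then have "{Upper i, Upper j} \<in> b2" using partner_edge[OF b(2), of "Upper i"] by simp
  then have "partner (compose_diagrams n b1 b2) (Upper i) = Upper j"
    using arc_nodes_compose(3)[OF b] partner_eqI compose_in_diagrams[OF b] by blast
  then show "i \<in> arc_nodes Upper n (compose_diagrams n b1 b2)"
    using ij by (simp add: arc_nodes_def)
qed

text \<open>The surviving arcs of a factor already account for all arcs of the product in that row,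
  by counting. So the product determines the lower arcs of the lower factor and the upper arcs of
  the upper one.\<close>

lemma partner_compose_arcs:
  assumes b: "b1 \<in> diagrams n" "b2 \<in> diagrams n"
    and num: "num_arcs b1 = num_arcs (compose_diagrams n b1 b2)"
      "num_arcs b2 = num_arcs (compose_diagrams n b1 b2)"
  shows "arc_nodes Lower n b1 = arc_nodes Lower n (compose_diagrams n b1 b2)"
    and "arc_nodes Upper n b2 = arc_nodes Upper n (compose_diagrams n b1 b2)"
    and "i \<in> arc_nodes Lower n (compose_diagrams n b1 b2) \<Longrightarrow>
      partner b1 (Lower i) = partner (compose_diagrams n b1 b2) (Lower i)"
    and "i \<in> arc_nodes Upper n (compose_diagrams n b1 b2) \<Longrightarrow>
      partner b2 (Upper i) = partner (compose_diagrams n b1 b2) (Upper i)"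
proof -
  let ?d = "compose_diagrams n b1 b2"
  have d: "?d \<in> diagrams n" using compose_in_diagrams[OF b] .
  show low: "arc_nodes Lower n b1 = arc_nodes Lower n ?d"
    using num(1) by (intro card_subset_eq arc_nodes_compose(1)[OF b])
      (simp_all add: card_arc_nodes(2)[OF b(1)] card_arc_nodes(2)[OF d])
  show up: "arc_nodes Upper n b2 = arc_nodes Upper n ?d"
    using num(2) by (intro card_subset_eq arc_nodes_Upper_compose[OF b])
      (simp_all add: card_arc_nodes(1)[OF b(2)] card_arc_nodes(1)[OF d])
  show "partner b1 (Lower i) = partner ?d (Lower i)" if "i \<in> arc_nodes Lower n ?d"
  proof -
    have "i \<in> arc_nodes Lower n b1" using that low by simp
    then obtain j where j: "i \<in> {1..n}" "partner b1 (Lower i) = Lower j" by (auto simp: arc_nodes_def)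
    then have "{Lower i, Lower j} \<in> b1" using partner_edge[OF b(1), of "Lower i"] by simp
    then show ?thesis using arc_nodes_compose(2)[OF b] partner_eqI[OF d] j(2) by metis
  qed
  show "partner b2 (Upper i) = partner ?d (Upper i)" if "i \<in> arc_nodes Upper n ?d"
  proof -
    have "i \<in> arc_nodes Upper n b2" using that up by simp
    then obtain j where j: "i \<in> {1..n}" "partner b2 (Upper i) = Upper j" by (auto simp: arc_nodes_def)
    then have "{Upper i, Upper j} \<in> b2" using partner_edge[OF b(2), of "Upper i"] by simp
    then show ?thesis using arc_nodes_compose(3)[OF b] partner_eqI[OF d] j(2) by metis
  qed
qed

section \<open>Diagrams with vertical through lines\<close>

definition straight :: "nat \<Rightarrow> diagram \<Rightarrow> bool" where
  "straight n b \<longleftrightarrow> (\<forall>i\<in>{1..n}. \<forall>j. partner b (Lower i) = Upper j \<longrightarrow> j = i)"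

text \<open>A column with a vertical through line does not count, both sides being
  \<open>Lower i\<close> there.\<close>

definition asymmetry :: "nat \<Rightarrow> diagram \<Rightarrow> nat set" where
  "asymmetry n b = {i \<in> {1..n}. partner b (Upper i) \<noteq> swap_row (partner b (Lower i))}"

lemma straight_Upper:
  assumes b: "b \<in> diagrams n" "straight n b" and i: "i \<in> {1..n}" "i \<notin> arc_nodes Upper n b"
  shows "partner b (Upper i) = Lower i" "partner b (Lower i) = Upper i"
proof -
  obtain j where j: "partner b (Upper i) = Lower j"
    using i by (cases "partner b (Upper i)") (auto simp: arc_nodes_def)
  then have "partner b (Lower j) = Upper i" "Lower j \<in> nodes n"
    using partner_partner[OF b(1), of "Upper i"] partner_in_nodes[OF b(1), of "Upper i"] i(1) by auto
  then show "partner b (Upper i) = Lower i" "partner b (Lower i) = Upper i"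
    using b(2) j by (auto simp: straight_def)
qed

lemma straight_Lower:
  assumes b: "b \<in> diagrams n" "straight n b" and i: "i \<in> {1..n}" "i \<notin> arc_nodes Lower n b"
  shows "partner b (Lower i) = Upper i"
  using assms by (cases "partner b (Lower i)") (auto simp: arc_nodes_def straight_def)

definition sym_straight :: "nat \<Rightarrow> nat \<Rightarrow> diagram set" where
  "sym_straight n f = {b \<in> diagrams n. num_arcs b = f \<and> straight n b \<and> relabel swap_row b = b}"

definition near_sym_straight :: "nat \<Rightarrow> nat \<Rightarrow> diagram set" where
  "near_sym_straight n f = {b \<in> diagrams n. num_arcs b = f \<and> straight n b \<and> card (asymmetry n b) \<le> 4}"

definition indicator_sum :: "diagram set \<Rightarrow> diagram \<Rightarrow> complex" where
  "indicator_sum S b = (if b \<in> S then 1 else 0)"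

lemma conj_invariant_indicator_sum:
  assumes "\<And>p b. p permutes {1..n} \<Longrightarrow> b \<in> S \<Longrightarrow> relabel (node_map p p) b \<in> S"
  shows "conj_invariant n (indicator_sum S)"
  unfolding conj_invariant_def
proof (intro allI impI ballI)
  fix p b assume p: "p permutes {1..n}"
  have "b \<in> S" if "relabel (node_map p p) b \<in> S"
    using assms[OF permutes_inv[OF p] that] relabel_node_map_inv[OF p p] by simp
  then show "indicator_sum S (relabel (node_map p p) b) = indicator_sum S b"
    using assms[OF p] by (auto simp: indicator_sum_def)
qed

lemma straight_node_map:
  assumes p: "p permutes {1..n}" and b: "b \<in> diagrams n" "straight n b"
  shows "straight n (relabel (node_map p p) b)"
  unfolding straight_def
proof (intro ballI allI impI)
  fix i j assume i: "i \<in> {1..n}" and j: "partner (relabel (node_map p p) b) (Lower i) = Upper j"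
  obtain k where k: "i = p k" "k \<in> {1..n}" using i permutes_image[OF p] by (metis imageE)
  then have "node_map p p (partner b (Lower k)) = Upper j"
    using j partner_relabel[OF bij_node_map[OF p p] b(1), of "Lower k"] by simp
  then obtain l where l: "partner b (Lower k) = Upper l" "j = p l"
    by (cases "partner b (Lower k)") auto
  then show "j = i" using b(2) k by (auto simp: straight_def)
qed

lemma asymmetry_node_map:
  assumes p: "p permutes {1..n}" and b: "b \<in> diagrams n"
  shows "asymmetry n (relabel (node_map p p) b) \<subseteq> p ` asymmetry n b"
proof
  fix i assume i: "i \<in> asymmetry n (relabel (node_map p p) b)"
  then obtain k where k: "i = p k" "k \<in> {1..n}"
    using permutes_image[OF p] unfolding asymmetry_def by (metis (no_types, lifting) imageE mem_Collect_eq)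
  have swap: "swap_row (node_map p p x) = node_map p p (swap_row x)" for x by (cases x) auto
  have "k \<in> asymmetry n b"
    using i k partner_relabel[OF bij_node_map[OF p p] b, of "Lower k"]
      partner_relabel[OF bij_node_map[OF p p] b, of "Upper k"]
    by (auto simp: asymmetry_def swap)
  then show "i \<in> p ` asymmetry n b" using k by simp
qed

lemma finite_asymmetry [simp]: "finite (asymmetry n b)"
  by (simp add: asymmetry_def)

lemma conj_invariant_sym_straight:
  "conj_invariant n (indicator_sum (sym_straight n f))"
  "conj_invariant n (indicator_sum (near_sym_straight n f))"
proof -
  have swap: "relabel swap_row (relabel (node_map p p) b) = relabel (node_map p p) (relabel swap_row b)" for p b
  proof -
    have "swap_row \<circ> node_map p p = node_map p p \<circ> swap_row"
    proof
      fix x show "(swap_row \<circ> node_map p p) x = (node_map p p \<circ> swap_row) x" by (cases x) auto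
    qed
    then show ?thesis by (simp add: relabel_relabel)
  qed
  have card: "card (asymmetry n (relabel (node_map p p) b)) \<le> card (asymmetry n b)"
    if "p permutes {1..n}" "b \<in> diagrams n" for p b
    using card_mono[OF _ asymmetry_node_map[OF that]] card_image_le[of "asymmetry n b" p] by simp
  show "conj_invariant n (indicator_sum (sym_straight n f))"
    by (rule conj_invariant_indicator_sum)
      (auto simp: sym_straight_def swap straight_node_map node_map_in_diagrams num_arcs_node_map)
  show "conj_invariant n (indicator_sum (near_sym_straight n f))"
    by (rule conj_invariant_indicator_sum)
      (auto simp: near_sym_straight_def straight_node_map node_map_in_diagrams num_arcs_node_map
        intro: order_trans[OF card])
qed

text \<open>The three diagrams below have \<open>m + 2\<close> arcs in each row. In \<open>path_partner\<close> the upper arcs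
  \<open>{2k - 1, 2k}\<close> and the lower arcs \<open>{2k, 2k + 1}\<close> form one path through the points \<open>1, \<dots>, 2m + 4\<close>,
  and there is one further lower arc \<open>{2m + 5, 2m + 6}\<close>; the through lines at the ends of the
  path and of this arc make the diagram inequivalent to its flip. It is the product of the other two,
  in one order only.\<close>

fun path_partner :: "nat \<Rightarrow> node \<Rightarrow> node" where
  "path_partner m (Upper i) = (if i \<le> 2 * m + 4 then (if odd i then Upper (i + 1) else Upper (i - 1))
     else if i = 2 * m + 5 then Lower 1 else if i = 2 * m + 6 then Lower (2 * m + 4) else Lower i)"
| "path_partner m (Lower i) = (if i = 1 then Upper (2 * m + 5) else if i = 2 * m + 4 then Upper (2 * m + 6)
     else if i < 2 * m + 4 then (if even i then Lower (i + 1) else Lower (i - 1))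
     else if i = 2 * m + 5 then Lower (2 * m + 6) else if i = 2 * m + 6 then Lower (2 * m + 5) else Upper i)"

fun sym_partner :: "nat \<Rightarrow> node \<Rightarrow> node" where
  "sym_partner m (Upper i) = (if i \<le> 2 * m + 4 then (if odd i then Upper (i + 1) else Upper (i - 1)) else Lower i)"
| "sym_partner m (Lower i) = (if i \<le> 2 * m + 4 then (if odd i then Lower (i + 1) else Lower (i - 1)) else Upper i)"

fun near_sym_partner :: "nat \<Rightarrow> node \<Rightarrow> node" where
  "near_sym_partner m (Upper i) = (if i = 1 \<or> i = 2 * m + 4 then Lower i
     else if i = 2 * m + 2 then Upper (2 * m + 5) else if i = 2 * m + 5 then Upper (2 * m + 2)
     else if i = 2 * m + 3 then Upper (2 * m + 6) else if i = 2 * m + 6 then Upper (2 * m + 3)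
     else if i < 2 * m + 2 then (if even i then Upper (i + 1) else Upper (i - 1)) else Lower i)"
| "near_sym_partner m (Lower i) = (if i = 1 \<or> i = 2 * m + 4 then Upper i
     else if i < 2 * m + 4 then (if even i then Lower (i + 1) else Lower (i - 1))
     else if i = 2 * m + 5 then Lower (2 * m + 6) else if i = 2 * m + 6 then Lower (2 * m + 5) else Upper i)"

section \<open>The target diagram and its two factors\<close>

lemma path_partner_involution:
  assumes "2 * m + 6 \<le> n" "x \<in> nodes n"
  shows "path_partner m x \<in> nodes n" "path_partner m x \<noteq> x" "path_partner m (path_partner m x) = x"
proof -
  show "path_partner m x \<in> nodes n" using assms by (cases x) (auto, (presburger+)?)
  show "path_partner m x \<noteq> x" using assms by (cases x) auto
  show "path_partner m (path_partner m x) = x" using assms by (cases x) (auto, (presburger+)?)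
qed

lemma sym_partner_involution:
  assumes "2 * m + 6 \<le> n" "x \<in> nodes n"
  shows "sym_partner m x \<in> nodes n" "sym_partner m x \<noteq> x" "sym_partner m (sym_partner m x) = x"
proof -
  show "sym_partner m x \<in> nodes n" using assms by (cases x) (auto, (presburger+)?)
  show "sym_partner m x \<noteq> x" using assms by (cases x) auto
  show "sym_partner m (sym_partner m x) = x" using assms by (cases x) (auto, (presburger+)?)
qed

lemma near_sym_partner_involution:
  assumes "2 * m + 6 \<le> n" "x \<in> nodes n"
  shows "near_sym_partner m x \<in> nodes n" "near_sym_partner m x \<noteq> x"
    "near_sym_partner m (near_sym_partner m x) = x"
proof -
  show "near_sym_partner m x \<in> nodes n" using assms by (cases x) (auto, (presburger+)?)
  show "near_sym_partner m x \<noteq> x" using assms by (cases x) auto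
  show "near_sym_partner m (near_sym_partner m x) = x" using assms by (cases x) (auto, (presburger+)?)
qed

definition diagram_of :: "nat \<Rightarrow> (node \<Rightarrow> node) \<Rightarrow> diagram" where
  "diagram_of n g = {{x, g x} | x. x \<in> nodes n}"

lemma path_diagram:
  assumes "2 * m + 6 \<le> n"
  shows "diagram_of n (path_partner m) \<in> diagrams n"
    "x \<in> nodes n \<Longrightarrow> partner (diagram_of n (path_partner m)) x = path_partner m x"
  unfolding diagram_of_def using path_partner_involution[OF assms]
  by (intro involution_diagram partner_involution; simp)+

lemma sym_diagram:
  assumes "2 * m + 6 \<le> n"
  shows "diagram_of n (sym_partner m) \<in> diagrams n"
    "x \<in> nodes n \<Longrightarrow> partner (diagram_of n (sym_partner m)) x = sym_partner m x"
  unfolding diagram_of_def using sym_partner_involution[OF assms]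
  by (intro involution_diagram partner_involution; simp)+

lemma near_sym_diagram:
  assumes "2 * m + 6 \<le> n"
  shows "diagram_of n (near_sym_partner m) \<in> diagrams n"
    "x \<in> nodes n \<Longrightarrow> partner (diagram_of n (near_sym_partner m)) x = near_sym_partner m x"
  unfolding diagram_of_def using near_sym_partner_involution[OF assms]
  by (intro involution_diagram partner_involution; simp)+

lemma arc_nodes_path_diagram:
  assumes "2 * m + 6 \<le> n"
  shows "arc_nodes Upper n (diagram_of n (path_partner m)) = {1..2 * m + 4}"
    "arc_nodes Lower n (diagram_of n (path_partner m)) = {2..2 * m + 3} \<union> {2 * m + 5, 2 * m + 6}"
proof -
  note p = path_diagram(2)[OF assms]
  have "i \<in> arc_nodes Upper n (diagram_of n (path_partner m)) \<longleftrightarrow> i \<in> {1..2 * m + 4}" for i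
    using assms by (auto simp: arc_nodes_def p split: if_splits)
  then show "arc_nodes Upper n (diagram_of n (path_partner m)) = {1..2 * m + 4}" by blast
  have "i \<in> arc_nodes Lower n (diagram_of n (path_partner m)) \<longleftrightarrow>
      i \<in> {2..2 * m + 3} \<union> {2 * m + 5, 2 * m + 6}" for i
    using assms by (auto simp: arc_nodes_def p split: if_splits)
  then show "arc_nodes Lower n (diagram_of n (path_partner m)) = {2..2 * m + 3} \<union> {2 * m + 5, 2 * m + 6}"
    by blast
qed

lemma num_arcs_path_diagram:
  assumes "2 * m + 6 \<le> n"
  shows "num_arcs (diagram_of n (path_partner m)) = m + 2"
  using card_arc_nodes(1)[OF path_diagram(1)[OF assms]] by (simp add: arc_nodes_path_diagram[OF assms])

lemma sym_diagram_in_sym_straight: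
  assumes "2 * m + 6 \<le> n"
  shows "diagram_of n (sym_partner m) \<in> sym_straight n (m + 2)"
proof -
  let ?b = "diagram_of n (sym_partner m)"
  note b = sym_diagram(1)[OF assms] and p = sym_diagram(2)[OF assms]
  have "i \<in> arc_nodes Upper n ?b \<longleftrightarrow> i \<in> {1..2 * m + 4}" for i
    using assms by (auto simp: arc_nodes_def p split: if_splits)
  then have "arc_nodes Upper n ?b = {1..2 * m + 4}" by blast
  then have "num_arcs ?b = m + 2" using card_arc_nodes(1)[OF b] by simp
  moreover have "straight n ?b" by (auto simp: straight_def p)
  moreover have "relabel swap_row ?b = ?b"
  proof (rule diagram_eqI[OF _ b])
    show "relabel swap_row ?b \<in> diagrams n" using b by simp
    fix x assume x: "x \<in> nodes n"
    have "partner (relabel swap_row ?b) x = swap_row (sym_partner m (swap_row x))"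
      using partner_relabel[OF bij_swap_row b, of "swap_row x"] x p[of "swap_row x"] by simp
    also have "\<dots> = sym_partner m x" by (cases x) auto
    finally show "{x, partner (relabel swap_row ?b) x} \<in> ?b" using partner_edge[OF b x] p[OF x] by simp
  qed
  ultimately show ?thesis using b by (simp add: sym_straight_def)
qed

text \<open>The lower arcs \<open>{2m + 2, 2m + 3}\<close> and \<open>{2m + 5, 2m + 6}\<close> are
  replaced in the upper row by \<open>{2m + 2, 2m + 5}\<close> and \<open>{2m + 3, 2m + 6}\<close>.
  Elsewhere the rows agree, so the bound four is attained.\<close>

lemma near_sym_diagram_in_near_sym_straight:
  assumes "2 * m + 6 \<le> n"
  shows "diagram_of n (near_sym_partner m) \<in> near_sym_straight n (m + 2)"
proof -
  let ?b = "diagram_of n (near_sym_partner m)"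
  note b = near_sym_diagram(1)[OF assms] and p = near_sym_diagram(2)[OF assms]
  have "i \<in> arc_nodes Lower n ?b \<longleftrightarrow> i \<in> {2..2 * m + 3} \<union> {2 * m + 5, 2 * m + 6}" for i
    using assms by (auto simp: arc_nodes_def p split: if_splits)
  then have "arc_nodes Lower n ?b = {2..2 * m + 3} \<union> {2 * m + 5, 2 * m + 6}" by blast
  then have "card (arc_nodes Lower n ?b) = 2 * m + 4" by (simp add: card_Un_disjoint)
  then have "num_arcs ?b = m + 2" using card_arc_nodes(2)[OF b] by simp
  moreover have "straight n ?b" by (auto simp: straight_def p split: if_splits)
  moreover have "card (asymmetry n ?b) \<le> 4"
  proof -
    have "asymmetry n ?b \<subseteq> {2 * m + 2, 2 * m + 3, 2 * m + 5, 2 * m + 6}"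
    proof
      fix i assume "i \<in> asymmetry n ?b"
      then have "i \<in> {1..n}" "partner ?b (Upper i) \<noteq> swap_row (partner ?b (Lower i))"
        by (simp_all add: asymmetry_def)
      then have i: "near_sym_partner m (Upper i) \<noteq> swap_row (near_sym_partner m (Lower i))"
        using p[of "Upper i"] p[of "Lower i"] by simp
      show "i \<in> {2 * m + 2, 2 * m + 3, 2 * m + 5, 2 * m + 6}"
      proof (rule ccontr)
        assume "i \<notin> {2 * m + 2, 2 * m + 3, 2 * m + 5, 2 * m + 6}"
        then consider "i = 1" | "i = 2 * m + 4" | "i \<noteq> 1" "i < 2 * m + 2" "i < 2 * m + 4" | "i > 2 * m + 6"
          by force
        then show False using i by cases (auto split: if_splits)
      qed
    qed
    then have "card (asymmetry n ?b) \<le> card {2 * m + 2, 2 * m + 3, 2 * m + 5, 2 * m + 6}"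
      by (intro card_mono) simp_all
    then show ?thesis by simp
  qed
  ultimately show ?thesis using b by (simp add: near_sym_straight_def)
qed

text \<open>In the middle row the arcs of the factors alternate along \<open>1, 2, 3, ...\<close>.
  Between \<open>2m + 2\<close> and \<open>2m + 3\<close> this path is cut: its halves are diverted
  to the columns \<open>2m + 5\<close> and \<open>2m + 6\<close> and leave there through the
  top.\<close>

lemma compose_near_sym_sym:
  assumes mn: "2 * m + 6 \<le> n"
  shows "compose_diagrams n (diagram_of n (near_sym_partner m)) (diagram_of n (sym_partner m)) =
    diagram_of n (path_partner m)"
proof -
  let ?b1 = "diagram_of n (near_sym_partner m)" and ?b2 = "diagram_of n (sym_partner m)"
  let ?L = "linked ?b1 ?b2"
  have below: "(place_below x, place_below (near_sym_partner m x)) \<in> ?L" if "x \<in> nodes n" for x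
    using linked_below[OF partner_edge[OF near_sym_diagram(1)[OF mn] that]] near_sym_diagram(2)[OF mn that]
    by simp
  have above: "(place_above x, place_above (sym_partner m x)) \<in> ?L" if "x \<in> nodes n" for x
    using linked_above[OF partner_edge[OF sym_diagram(1)[OF mn] that]] sym_diagram(2)[OF mn that]
    by simp
  have odd_step: "(Mid i, Mid (i + 1)) \<in> ?L" if "odd i" "i \<le> 2 * m + 3" for i
  proof -
    have "Lower i \<in> nodes n" using that mn by (auto elim: oddE)
    then show ?thesis using above[of "Lower i"] that by (auto split: if_splits)
  qed
  have even_step: "(Mid i, Mid (i + 1)) \<in> ?L" if "even i" "2 \<le> i" "i < 2 * m + 2" for i
    using below[of "Upper i"] that mn by (auto split: if_splits)
  have chain: "(Mid 1, Mid (2 * k + 2)) \<in> ?L" if "k \<le> m" for k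
    using that
  proof (induction k)
    case 0
    then show ?case using odd_step[of 1] by simp
  next
    case (Suc k)
    then have "(Mid 1, Mid (2 * k + 2)) \<in> ?L" by simp
    also have "(Mid (2 * k + 2), Mid (2 * k + 2 + 1)) \<in> ?L"
      by (rule even_step) (use Suc.prems in simp_all)
    also have "(Mid (2 * k + 2 + 1), Mid (2 * k + 2 + 1 + 1)) \<in> ?L"
      by (rule odd_step) (use Suc.prems in simp_all)
    finally show ?case by simp
  qed
  have first: "(Bot 1, Top (2 * m + 5)) \<in> ?L"
  proof -
    have "(Bot 1, Mid 1) \<in> ?L" using below[of "Lower 1"] mn by simp
    also have "(Mid 1, Mid (2 * m + 2)) \<in> ?L" using chain[of m] by simp
    also have "(Mid (2 * m + 2), Mid (2 * m + 5)) \<in> ?L" using below[of "Upper (2 * m + 2)"] mn by simp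
    also have "(Mid (2 * m + 5), Top (2 * m + 5)) \<in> ?L" using above[of "Lower (2 * m + 5)"] mn by simp
    finally show ?thesis .
  qed
  have last: "(Bot (2 * m + 4), Top (2 * m + 6)) \<in> ?L"
  proof -
    have "(Bot (2 * m + 4), Mid (2 * m + 4)) \<in> ?L" using below[of "Lower (2 * m + 4)"] mn by simp
    also have "(Mid (2 * m + 4), Mid (2 * m + 3)) \<in> ?L" using above[of "Lower (2 * m + 4)"] mn
      by (simp add: add.commute)
    also have "(Mid (2 * m + 3), Mid (2 * m + 6)) \<in> ?L" using below[of "Upper (2 * m + 3)"] mn by simp
    also have "(Mid (2 * m + 6), Top (2 * m + 6)) \<in> ?L" using above[of "Lower (2 * m + 6)"] mn by simp
    finally show ?thesis .
  qed
  have straight: "(Bot i, Top i) \<in> ?L" if "i > 2 * m + 6" "i \<le> n" for i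
  proof -
    have "(Bot i, Mid i) \<in> ?L" using below[of "Lower i"] that by simp
    also have "(Mid i, Top i) \<in> ?L" using above[of "Lower i"] that by simp
    finally show ?thesis .
  qed
  show ?thesis
  proof (rule compose_eqI[OF near_sym_diagram(1)[OF mn] sym_diagram(1)[OF mn] path_diagram(1)[OF mn]])
    fix x assume x: "x \<in> nodes n"
    show "(outer x, outer (partner (diagram_of n (path_partner m)) x)) \<in> ?L"
      unfolding path_diagram(2)[OF mn x]
    proof (cases x)
      case (Lower i)
      consider "i = 1" | "i = 2 * m + 4" | "i > 2 * m + 6"
        | "i \<noteq> 1" "i < 2 * m + 4" | "i = 2 * m + 5" | "i = 2 * m + 6" by linarith
      then show "(outer x, outer (path_partner m x)) \<in> ?L"
      proof cases
        case 4
        then have "outer (path_partner m x) = place_below (near_sym_partner m x)" "outer x = place_below x"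
          using Lower by simp_all
        then show ?thesis using below[OF x] by simp
      qed (use Lower x first last straight below[OF x] in simp_all)
    next
      case (Upper i)
      consider "i \<le> 2 * m + 4" | "i > 2 * m + 6" | "i = 2 * m + 5" | "i = 2 * m + 6" by linarith
      then show "(outer x, outer (path_partner m x)) \<in> ?L"
      proof cases
        case 1
        then have "outer (path_partner m x) = place_above (sym_partner m x)" "outer x = place_above x"
          using Upper by simp_all
        then show ?thesis using above[OF x] by simp
      qed (use Upper x linked_sym[OF first] linked_sym[OF last] linked_sym[OF straight] in simp_all)
    qed
  qed
qed

lemma partner_swap_row_eq:
  assumes "b \<in> diagrams n" "relabel swap_row b = b" "x \<in> nodes n"
  shows "partner b (swap_row x) = swap_row (partner b x)"
  using partner_relabel[OF bij_swap_row assms(1,3)] assms(2) by simp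

text \<open>The target forces the lower arc \<open>{?s, ?t}\<close> on \<open>b1\<close>, whose
  symmetry repeats it in the upper row. The columns \<open>?s\<close> and \<open>?t\<close> are not
  on upper arcs of \<open>b2\<close>, so its vertical lines carry this arc to the top row of the
  product, where the target has ends of through lines.\<close>

lemma compose_sym_near_sym:
  assumes mn: "2 * m + 6 \<le> n"
    and b1: "b1 \<in> sym_straight n (m + 2)" and b2: "b2 \<in> near_sym_straight n (m + 2)"
  shows "compose_diagrams n b1 b2 \<noteq> diagram_of n (path_partner m)"
proof
  let ?d = "diagram_of n (path_partner m)" and ?s = "2 * m + 5" and ?t = "2 * m + 6"
  assume eq: "compose_diagrams n b1 b2 = ?d"
  have b: "b1 \<in> diagrams n" "b2 \<in> diagrams n"
    using b1 b2 by (auto simp: sym_straight_def near_sym_straight_def)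
  note arcs = partner_compose_arcs[OF b, unfolded eq num_arcs_path_diagram[OF mn]
      arc_nodes_path_diagram[OF mn]]
  have num: "num_arcs b1 = m + 2" "num_arcs b2 = m + 2"
    using b1 b2 by (auto simp: sym_straight_def near_sym_straight_def)
  have st: "Lower ?s \<in> nodes n" "Upper ?s \<in> nodes n" "Lower ?t \<in> nodes n" "Upper ?t \<in> nodes n"
    using mn by simp_all
  have "partner b1 (Lower ?s) = Lower ?t"
    using arcs(3)[OF num, of ?s] path_diagram(2)[OF mn st(1)] by simp
  then have "partner b1 (Upper ?s) = Upper ?t"
    using partner_swap_row_eq[OF b(1) _ st(1)] b1 by (simp add: sym_straight_def)
  then have mid: "(Mid ?s, Mid ?t) \<in> linked b1 b2"
    using linked_below[OF partner_edge[OF b(1) st(2)]] by simp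
  have "partner b2 (Lower i) = Upper i" if "i \<in> {?s, ?t}" for i
    using straight_Upper(2)[OF b(2), of i] b2 arcs(2)[OF num] that mn
    by (auto simp: near_sym_straight_def)
  then have "(Mid i, Top i) \<in> linked b1 b2" if "i \<in> {?s, ?t}" for i
    using linked_above[OF partner_edge[OF b(2), of "Lower i"]] that mn by auto
  then have "(Top ?s, Top ?t) \<in> linked b1 b2"
    using mid linked_sym linked_trans by (metis insertI1 insertI2)
  then have "{Upper ?s, Upper ?t} \<in> ?d"
    using compose_edge[OF st(2,4), of b1 b2] eq by simp
  then show False
    using partner_eqI[OF path_diagram(1)[OF mn]] path_diagram(2)[OF mn st(2)] by fastforce
qed

text \<open>Numbering the middle nodes along the path of the product, every node of a closed loop would
  be linked to its predecessor on the path.\<close>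

lemma num_loops_near_sym_sym:
  assumes mn: "2 * m + 6 \<le> n"
    and b1: "b1 \<in> near_sym_straight n (m + 2)" and b2: "b2 \<in> sym_straight n (m + 2)"
    and eq: "compose_diagrams n b1 b2 = diagram_of n (path_partner m)"
  shows "num_loops n b1 b2 = 0"
proof -
  let ?d = "diagram_of n (path_partner m)" and ?s = "2 * m + 5" and ?t = "2 * m + 6"
  let ?L = "linked b1 b2"
  have b: "b1 \<in> diagrams n" "b2 \<in> diagrams n" and num: "num_arcs b1 = m + 2" "num_arcs b2 = m + 2"
    and str: "straight n b1" "straight n b2" and card4: "card (asymmetry n b1) \<le> 4"
    and swap: "relabel swap_row b2 = b2"
    using b1 b2 by (auto simp: sym_straight_def near_sym_straight_def)
  note arcs = partner_compose_arcs[OF b, unfolded eq num_arcs_path_diagram[OF mn]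
      arc_nodes_path_diagram[OF mn], OF num]
  have st: "Lower ?s \<in> nodes n" "Upper ?s \<in> nodes n" "Lower ?t \<in> nodes n" "Upper ?t \<in> nodes n"
    using mn by simp_all
  have b2_arc: "(Mid i, Mid (i - 1)) \<in> ?L" if "even i" "1 \<le> i" "i \<le> 2 * m + 4" for i
  proof -
    have i: "Upper i \<in> nodes n" using that mn by simp
    have "partner b2 (Upper i) = Upper (i - 1)"
      using arcs(4)[of i] path_diagram(2)[OF mn i] that by simp
    then have "partner b2 (Lower i) = Lower (i - 1)"
      using partner_swap_row_eq[OF b(2) swap i] by simp
    then show ?thesis using linked_above[OF partner_edge[OF b(2), of "Lower i"]] i by simp
  qed
  have b2_top: "(Mid i, Top i) \<in> ?L" if "2 * m + 4 < i" "i \<le> n" for i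
  proof -
    have "partner b2 (Lower i) = Upper i"
      using straight_Upper(2)[OF b(2) str(2), of i] arcs(2) that by simp
    then show ?thesis using linked_above[OF partner_edge[OF b(2), of "Lower i"]] that by simp
  qed
  have b1_st: "partner b1 (Lower ?s) = Lower ?t" "partner b1 (Lower ?t) = Lower ?s"
    using arcs(3)[of ?s] arcs(3)[of ?t] path_diagram(2)[OF mn st(1)] path_diagram(2)[OF mn st(3)] by simp_all
  \<comment> \<open>The lower nodes of these columns are joined by an arc, so their upper nodes
    cannot lie on vertical lines.\<close>
  have upper: "\<exists>j. partner b1 (Upper i) = Upper j" if "i \<in> {?s, ?t}" for i
  proof -
    have "i \<in> {1..n}" using that mn by auto
    then have "i \<in> arc_nodes Upper n b1"
      using straight_Upper(2)[OF b(1) str(1), of i] b1_st that by (metis insertE node.distinct(1) singletonD)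
    then show ?thesis by (auto simp: arc_nodes_def)
  qed
  obtain s' where s': "partner b1 (Upper ?s) = Upper s'" using upper by blast
  obtain t' where t': "partner b1 (Upper ?t) = Upper t'" using upper by blast
  have back': "partner b1 (Upper s') = Upper ?s" "partner b1 (Upper t') = Upper ?t"
    "Upper s' \<in> nodes n" "Upper t' \<in> nodes n"
    using partner_partner[OF b(1) st(2)] partner_partner[OF b(1) st(4)]
      partner_in_nodes[OF b(1) st(2)] partner_in_nodes[OF b(1) st(4)] s' t' by simp_all
  \<comment> \<open>An upper arc \<open>{?s, ?t}\<close> of \<open>b1\<close> would reach the top
    row through the vertical lines of \<open>b2\<close>, but the target has no such arc.\<close>
  have s't: "s' \<noteq> ?t"
  proof
    assume "s' = ?t"
    then have mid: "(Mid ?s, Mid ?t) \<in> ?L"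
      using linked_below[OF partner_edge[OF b(1) st(2)]] s' by simp
    have "(Mid ?s, Top ?s) \<in> ?L" "(Mid ?t, Top ?t) \<in> ?L" using b2_top mn by simp_all
    then have "(Top ?s, Top ?t) \<in> ?L" using mid linked_sym linked_trans by metis
    then have "{Upper ?s, Upper ?t} \<in> ?d"
      using compose_edge[OF st(2,4), of b1 b2] eq by simp
    then show False
      using partner_eqI[OF path_diagram(1)[OF mn]] path_diagram(2)[OF mn st(2)] by fastforce
  qed
  have t's: "t' \<noteq> ?s" using back'(2) s' s't by auto
  have "s' \<noteq> ?s" "t' \<noteq> ?t" using partner_neq[OF b(1) st(2)] partner_neq[OF b(1) st(4)] s' t' by auto
  moreover have "s' \<noteq> t'" using back' by auto
  ultimately have "card {?s, ?t, s', t'} = 4" using s't t's by simp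
  moreover have "{?s, ?t, s', t'} \<subseteq> asymmetry n b1"
  proof -
    have "partner b1 (Lower s') \<noteq> Lower ?s" "partner b1 (Lower t') \<noteq> Lower ?t"
      using partner_partner[OF b(1), of "Lower s'"] partner_partner[OF b(1), of "Lower t'"]
        b1_st back' s't t's by auto
    moreover have "swap_row x = Upper i \<longleftrightarrow> x = Lower i" for x i by (cases x) auto
    ultimately have ne: "Upper ?s \<noteq> swap_row (partner b1 (Lower s'))"
      "Upper ?t \<noteq> swap_row (partner b1 (Lower t'))" by metis+
    have "?s \<in> asymmetry n b1" using s' b1_st(1) s't mn by (simp add: asymmetry_def)
    moreover have "?t \<in> asymmetry n b1" using t' b1_st(2) t's mn by (simp add: asymmetry_def)
    moreover have "s' \<in> asymmetry n b1" using ne(1) back' by (simp add: asymmetry_def)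
    moreover have "t' \<in> asymmetry n b1" using ne(2) back' by (simp add: asymmetry_def)
    ultimately show ?thesis by simp
  qed
  \<comment> \<open>The four forced columns exhaust the bound, so \<open>b1\<close> is symmetric in
    all the others.\<close>
  ultimately have asym: "asymmetry n b1 = {?s, ?t, s', t'}"
    using card4 card_seteq[of "asymmetry n b1" "{?s, ?t, s', t'}"] by simp
  have "\<not> K \<subseteq> range Mid" if K: "K \<in> Mid ` {1..n} // ?L" for K
  proof
    assume sub: "K \<subseteq> range Mid"
    obtain i0 where i0: "i0 \<in> {1..n}" "K = ?L `` {Mid i0}" using K by (auto simp: quotient_def)
    have closed: "v \<in> K" if "u \<in> K" "(u, v) \<in> ?L" for u v
      using that linked_trans unfolding i0(2) by blast
    have no_outer: "Top i \<notin> K" "Bot i \<notin> K" for i using sub by auto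
    \<comment> \<open>The smallest column of the loop; a link to \<open>v - 1\<close> is the
      contradiction aimed at.\<close>
    define v where "v = (LEAST i. i \<in> {1..n} \<and> Mid i \<in> K)"
    have "Mid i0 \<in> K" using i0(2) by simp
    then have v: "v \<in> {1..n}" "Mid v \<in> K"
      using LeastI[of "\<lambda>i. i \<in> {1..n} \<and> Mid i \<in> K" i0] i0(1) by (auto simp: v_def)
    have "(Mid v, Mid (v - 1)) \<notin> ?L" if "2 \<le> v"
    proof
      assume "(Mid v, Mid (v - 1)) \<in> ?L"
      then have "Mid (v - 1) \<in> K" using closed v(2) by blast
      moreover have "v - 1 < v" "v - 1 \<in> {1..n}" using that v(1) by auto
      ultimately show False
        using not_less_Least[of "v - 1" "\<lambda>i. i \<in> {1..n} \<and> Mid i \<in> K", folded v_def] by blast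
    qed
    moreover have "v \<le> 2 * m + 4" using b2_top[of v] closed v no_outer by (meson atLeastAtMost_iff not_le)
    \<comment> \<open>For even \<open>v\<close>, the lower arc of \<open>b2\<close> at
      \<open>v\<close> would lead to \<open>v - 1\<close>.\<close>
    ultimately have "odd v" using b2_arc[of v] v(1) by (cases "v = 1") auto
    have "v \<noteq> 1"
    proof
      assume v1: "v = 1"
      have "partner b1 (Lower 1) = Upper 1"
        using straight_Lower[OF b(1) str(1), of 1] arcs(1) mn by simp
      then have "(Bot 1, Mid 1) \<in> ?L"
        using linked_below[OF partner_edge[OF b(1), of "Lower 1"]] mn by simp
      then show False using closed v(2) v1 linked_sym no_outer by blast
    qed
    then have v3: "3 \<le> v" "v \<le> 2 * m + 3"
      using \<open>odd v\<close> \<open>v \<le> 2 * m + 4\<close> by presburger+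
    \<comment> \<open>The four asymmetric columns are all linked to the top row, hence lie on no
      loop.\<close>
    have "v \<notin> asymmetry n b1"
    proof -
      have "(Mid ?s, Mid s') \<in> ?L" "(Mid ?t, Mid t') \<in> ?L"
        using linked_below[OF partner_edge[OF b(1) st(2)]] linked_below[OF partner_edge[OF b(1) st(4)]] s' t'
        by simp_all
      moreover have "(Mid ?s, Top ?s) \<in> ?L" "(Mid ?t, Top ?t) \<in> ?L" using b2_top mn by simp_all
      ultimately have "Mid ?s \<notin> K" "Mid ?t \<notin> K" "Mid s' \<notin> K" "Mid t' \<notin> K"
        using closed no_outer linked_sym by blast+
      then show ?thesis using v(2) asym by auto
    qed
    moreover have "partner b1 (Lower v) = Lower (v - 1)"
      using arcs(3)[of v] path_diagram(2)[OF mn, of "Lower v"] v3 v(1) \<open>odd v\<close> by simp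
    \<comment> \<open>The lower arc that \<open>b1\<close> shares with the target is repeated in the
      upper row, as \<open>v\<close> is a symmetric column.\<close>
    ultimately have "partner b1 (Upper v) = Upper (v - 1)" using v(1) by (simp add: asymmetry_def)
    then have "(Mid v, Mid (v - 1)) \<in> ?L"
      using linked_below[OF partner_edge[OF b(1), of "Upper v"]] v(1) by simp
    then show False
      using \<open>2 \<le> v \<Longrightarrow> (Mid v, Mid (v - 1)) \<notin> ?L\<close> v3 by simp
  qed
  then show ?thesis unfolding num_loops_def by (simp add: card_eq_0_iff)
qed

section \<open>Failure of commutativity\<close>

lemma sym_straight_noncommuting:
  assumes mn: "2 * m + 6 \<le> n"
  defines "x \<equiv> indicator_sum (sym_straight n (m + 2))"
    and "y \<equiv> indicator_sum (near_sym_straight n (m + 2))"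
    and "d \<equiv> diagram_of n (path_partner m)"
  shows "(x \<otimes>\<^bsub>brauer n \<delta>\<^esub> y) d \<noteq> (y \<otimes>\<^bsub>brauer n \<delta>\<^esub> x) d"
proof -
  \<comment> \<open>The number of factorisations of \<open>d\<close>, counted in the natural
    numbers, where nothing can cancel.\<close>
  define S :: nat where "S = (\<Sum>b1\<in>diagrams n. \<Sum>b2\<in>diagrams n.
    if compose_diagrams n b1 b2 = d \<and> b1 \<in> near_sym_straight n (m + 2) \<and> b2 \<in> sym_straight n (m + 2)
    then 1 else 0)"
  have "(x \<otimes>\<^bsub>brauer n \<delta>\<^esub> y) d = 0"
    unfolding brauer_mult
    by (intro sum.neutral ballI)
      (use compose_sym_near_sym[OF mn] in \<open>auto simp: x_def y_def d_def indicator_sum_def\<close>)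
  moreover have "(y \<otimes>\<^bsub>brauer n \<delta>\<^esub> x) d = of_nat S"
    unfolding brauer_mult S_def of_nat_sum
    by (intro sum.cong refl)
      (use num_loops_near_sym_sym[OF mn] in \<open>auto simp: x_def y_def d_def indicator_sum_def\<close>)
  moreover have "S \<noteq> 0"
    using near_sym_diagram_in_near_sym_straight[OF mn] sym_diagram_in_sym_straight[OF mn]
      near_sym_diagram(1)[OF mn] sym_diagram(1)[OF mn] compose_near_sym_sym[OF mn]
    by (auto simp: S_def sum_eq_0_iff finite_diagrams d_def)
  ultimately show ?thesis by simp
qed

lemma sym_straight_in_ideal:
  "indicator_sum (sym_straight n f) \<in> centraliser_ideal n \<delta> f"
  "indicator_sum (near_sym_straight n f) \<in> centraliser_ideal n \<delta> f"
  using conj_invariant_sym_straight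
  by (auto simp: centraliser_ideal_iff arc_ideal_def diagram_span_def indicator_sum_def
      sym_straight_def near_sym_straight_def)

text \<open>The ideals decrease with \<open>f\<close>, so the pair with \<open>m + 2\<close> arcs
  lies in all of those considered.\<close>

lemma not_commutative_centraliser_ideal:
  assumes "2 * m + 6 \<le> n" "f \<le> m + 2"
  shows "\<not> commutative ((centraliser_algebra n \<delta>)\<lparr>carrier := centraliser_ideal n \<delta> f\<rparr>)"
proof -
  have "centraliser_ideal n \<delta> (m + 2) \<subseteq> centraliser_ideal n \<delta> f"
    using assms(2) by (auto simp: centraliser_ideal_def arc_ideal_def diagram_span_def)
  then have "indicator_sum (sym_straight n (m + 2)) \<in> centraliser_ideal n \<delta> f"
    "indicator_sum (near_sym_straight n (m + 2)) \<in> centraliser_ideal n \<delta> f"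
    using sym_straight_in_ideal by blast+
  then show ?thesis
    using sym_straight_noncommuting[OF assms(1), of \<delta>] unfolding commutative_def by fastforce
qed

text \<open>For \<open>m = 0\<close> the target has two arcs, so its coefficient is visible modulo
  the ideal once \<open>f \<ge> 3\<close>.\<close>

lemma not_commutative_centraliser_quotient:
  assumes "6 \<le> n" "3 \<le> f"
  shows "\<not> commutative (centraliser_algebra n \<delta> Quot centraliser_ideal n \<delta> f)"
proof (rule not_commutative_quotient)
  have n: "2 * 0 + 6 \<le> n" using assms(1) by simp
  show "indicator_sum (sym_straight n (0 + 2)) \<in> carrier (centraliser_algebra n \<delta>)"
    "indicator_sum (near_sym_straight n (0 + 2)) \<in> carrier (centraliser_algebra n \<delta>)"
    using sym_straight_in_ideal[of n "0 + 2" \<delta>] by (simp_all add: centraliser_ideal_def)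
  show "diagram_of n (path_partner 0) \<in> diagrams n" using path_diagram(1)[OF n] .
  show "num_arcs (diagram_of n (path_partner 0)) < f" using num_arcs_path_diagram[OF n] assms(2) by simp
  show "(indicator_sum (sym_straight n (0 + 2)) \<otimes>\<^bsub>brauer n \<delta>\<^esub> indicator_sum (near_sym_straight n (0 + 2)))
      (diagram_of n (path_partner 0)) \<noteq>
    (indicator_sum (near_sym_straight n (0 + 2)) \<otimes>\<^bsub>brauer n \<delta>\<^esub> indicator_sum (sym_straight n (0 + 2)))
      (diagram_of n (path_partner 0))"
    using sym_straight_noncommuting[OF n] .
qed

theorem lemma5p6:
  fixes n :: nat and \<delta> :: complex
  shows "(n \<le> 5 \<longrightarrow> commutative (centraliser_algebra n \<delta>))
    \<and> (n \<ge> 6 \<longrightarrow>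
         \<not> commutative (centraliser_algebra n \<delta>)
       \<and> (\<forall>f \<in> {1, 2}. commutative (centraliser_algebra n \<delta> Quot centraliser_ideal n \<delta> f))
       \<and> (\<forall>f \<in> {3..n div 2}.
            \<not> commutative (centraliser_algebra n \<delta> Quot centraliser_ideal n \<delta> f))
       \<and> commutative ((centraliser_algebra n \<delta>)\<lparr>carrier := centraliser_ideal n \<delta> (n div 2)\<rparr>)
       \<and> (\<forall>f \<in> {0..n div 2 - 1}.
            \<not> commutative ((centraliser_algebra n \<delta>)\<lparr>carrier := centraliser_ideal n \<delta> f\<rparr>)))"
proof (intro conjI impI ballI)
  assume n: "n \<le> 5"
  have "flip_conjugate n b" if b: "b \<in> diagrams n" for b
  proof (rule flip_conjugateI[OF b])
    \<comment> \<open>Here \<open>n div 2 \<le> 2\<close>, so a diagram with more than one arc has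
      the maximal number.\<close>
    show "num_arcs b \<le> 1 \<or> num_arcs b = n div 2" using num_arcs_le[OF b] n by linarith
  qed
  then show "commutative (centraliser_algebra n \<delta>)"
    unfolding commutative_centraliser_iff_ideal by (intro commutative_centraliser_ideal)
next
  assume n: "6 \<le> n"
  \<comment> \<open>The largest value with \<open>2 * m + 6 \<le> n\<close>, so that
    \<open>m + 2\<close> is the last \<open>f\<close> in the claim on ideals; the subtraction is
    exact as \<open>n \<ge> 6\<close>.\<close>
  define m where "m = n div 2 - 3"
  have m: "2 * m + 6 \<le> n" "m + 2 = n div 2 - 1" using n by (auto simp: m_def)
  show "\<not> commutative (centraliser_algebra n \<delta>)"
    unfolding commutative_centraliser_iff_ideal
    using not_commutative_centraliser_ideal[OF m(1)] by simp
  show "commutative (centraliser_algebra n \<delta> Quot centraliser_ideal n \<delta> f)" if "f \<in> {1, 2}" for f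
    using that by (intro commutative_quotient flip_conjugateI) auto
  show "\<not> commutative (centraliser_algebra n \<delta> Quot centraliser_ideal n \<delta> f)"
    if "f \<in> {3..n div 2}" for f
    using that not_commutative_centraliser_quotient[OF n] by simp
  show "commutative ((centraliser_algebra n \<delta>)\<lparr>carrier := centraliser_ideal n \<delta> (n div 2)\<rparr>)"
  proof (rule commutative_centraliser_ideal)
    fix b assume b: "b \<in> diagrams n" "n div 2 \<le> num_arcs b"
    then show "flip_conjugate n b" using num_arcs_le[OF b(1)] by (intro flip_conjugateI) auto
  qed
  show "\<not> commutative ((centraliser_algebra n \<delta>)\<lparr>carrier := centraliser_ideal n \<delta> f\<rparr>)"
    if "f \<in> {0..n div 2 - 1}" for f
    using that m by (intro not_commutative_centraliser_ideal[OF m(1)]) simp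
qed

end
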